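(* Let $P$ be an infinite field, $X$ a set with exactly $2$ elements, and $F=F(X)$ the free Lie algebra over $P$ on $X$. Let $\tau:\mathrm{Aut}(\mathrm{End}(F))\to\mathrm{Aut}(\mathrm{Aut}(F))$ be the homomorphism sending an automorphism of the semigroup $\mathrm{End}(F)$ to its restriction to $\mathrm{Aut}(F)$. Then $\ker\tau$ consists of the automorphisms $\hat f_a$, $a\in P^*$.
   Context: $\mathrm{End}(F)$ is the semigroup of Lie $P$-algebra endomorphisms of $F$ and $\mathrm{Aut}(F)$ its group of invertible elements. $P^*=P\setminus\{0\}$. For $a\in P^*$, $f_a$ is the scalar automorphism of $F(X)$ defined by $f_a(x)=ax$ for all $x\in X$, and $\hat f_a$ is the inner automorphism of $\mathrm{End}(F(X))$ defined by $\hat f_a(\varphi)=f_a\varphi f_a^{-1}$. *)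

theory Defs
  imports Complex_Main "HOL-Algebra.Coset" "HOL-Algebra.Bij" "HOL-Library.Cardinality"
begin

section \<open>Lie algebras\<close>

text \<open>The condition \<open>[x, x] = 0\<close> is required (not merely antisymmetry), as is proper for
  fields of arbitrary characteristic, including 2.\<close>

locale lie_algebra = vector_space scale
  for scale :: "'p::field \<Rightarrow> 'l::ab_group_add \<Rightarrow> 'l" +
  fixes bracket :: "'l \<Rightarrow> 'l \<Rightarrow> 'l"
  assumes bracket_add_left: "bracket (x + y) z = bracket x z + bracket y z"
    and bracket_add_right: "bracket x (y + z) = bracket x y + bracket x z"
    and bracket_scale_left: "bracket (scale a x) y = scale a (bracket x y)"
    and bracket_scale_right: "bracket x (scale a y) = scale a (bracket x y)"
    and bracket_self: "bracket x x = 0"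
    and jacobi: "bracket x (bracket y z) + bracket y (bracket z x) + bracket z (bracket x y) = 0"

definition lie_hom ::
  "('p::field \<Rightarrow> 'l::ab_group_add \<Rightarrow> 'l) \<Rightarrow> ('l \<Rightarrow> 'l \<Rightarrow> 'l) \<Rightarrow>
   ('p \<Rightarrow> 'm::ab_group_add \<Rightarrow> 'm) \<Rightarrow> ('m \<Rightarrow> 'm \<Rightarrow> 'm) \<Rightarrow> ('l \<Rightarrow> 'm) \<Rightarrow> bool" where
  "lie_hom s1 b1 s2 b2 f \<longleftrightarrow>
     Vector_Spaces.linear s1 s2 f \<and> (\<forall>x y. f (b1 x y) = b2 (f x) (f y))"


section \<open>The free Lie algebra\<close>

text \<open>The type \<open>('p, 'x) free_lie\<close> is the free Lie algebra over the field \<open>'p\<close> on the set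
  of all elements of \<open>'x\<close>, constructed as the absolutely free algebra of Lie terms modulo the
  least congruence containing the identities of Lie algebras.\<close>

datatype ('p, 'x) lie_term =
    TGen 'x
  | TZero
  | TAdd "('p, 'x) lie_term" "('p, 'x) lie_term"
  | TNeg "('p, 'x) lie_term"
  | TScale 'p "('p, 'x) lie_term"
  | TBracket "('p, 'x) lie_term" "('p, 'x) lie_term"

inductive lie_eq :: "('p::field, 'x) lie_term \<Rightarrow> ('p, 'x) lie_term \<Rightarrow> bool" where
  refl: "lie_eq s s"
| sym: "lie_eq s t \<Longrightarrow> lie_eq t s"
| trans: "lie_eq s t \<Longrightarrow> lie_eq t u \<Longrightarrow> lie_eq s u"
| cong_add: "lie_eq s s' \<Longrightarrow> lie_eq t t' \<Longrightarrow> lie_eq (TAdd s t) (TAdd s' t')"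
| cong_neg: "lie_eq s s' \<Longrightarrow> lie_eq (TNeg s) (TNeg s')"
| cong_scale: "lie_eq s s' \<Longrightarrow> lie_eq (TScale a s) (TScale a s')"
| cong_bracket: "lie_eq s s' \<Longrightarrow> lie_eq t t' \<Longrightarrow> lie_eq (TBracket s t) (TBracket s' t')"
| add_assoc: "lie_eq (TAdd (TAdd s t) u) (TAdd s (TAdd t u))"
| add_comm: "lie_eq (TAdd s t) (TAdd t s)"
| add_zero: "lie_eq (TAdd TZero s) s"
| add_neg: "lie_eq (TAdd (TNeg s) s) TZero"
| scale_add: "lie_eq (TScale a (TAdd s t)) (TAdd (TScale a s) (TScale a t))"
| add_scale: "lie_eq (TScale (a + b) s) (TAdd (TScale a s) (TScale b s))"
| scale_scale: "lie_eq (TScale a (TScale b s)) (TScale (a * b) s)"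
| scale_one: "lie_eq (TScale 1 s) s"
| br_add_left: "lie_eq (TBracket (TAdd s t) u) (TAdd (TBracket s u) (TBracket t u))"
| br_add_right: "lie_eq (TBracket s (TAdd t u)) (TAdd (TBracket s t) (TBracket s u))"
| br_scale_left: "lie_eq (TBracket (TScale a s) t) (TScale a (TBracket s t))"
| br_scale_right: "lie_eq (TBracket s (TScale a t)) (TScale a (TBracket s t))"
| br_self: "lie_eq (TBracket s s) TZero"
| br_jacobi: "lie_eq (TAdd (TAdd (TBracket s (TBracket t u)) (TBracket t (TBracket u s)))
                (TBracket u (TBracket s t))) TZero"

quotient_type (overloaded) ('p, 'x) free_lie = "('p::field, 'x) lie_term" / lie_eq
  by (rule equivpI)
    (auto intro!: reflpI sympI transpI intro: lie_eq.refl lie_eq.sym lie_eq.trans)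

instantiation free_lie :: (field, type) ab_group_add
begin

lift_definition zero_free_lie :: "('a, 'b) free_lie" is TZero .

lift_definition plus_free_lie :: "('a, 'b) free_lie \<Rightarrow> ('a, 'b) free_lie \<Rightarrow> ('a, 'b) free_lie"
  is TAdd by (rule lie_eq.cong_add)

lift_definition uminus_free_lie :: "('a, 'b) free_lie \<Rightarrow> ('a, 'b) free_lie"
  is TNeg by (rule lie_eq.cong_neg)

definition minus_free_lie :: "('a, 'b) free_lie \<Rightarrow> ('a, 'b) free_lie \<Rightarrow> ('a, 'b) free_lie"
  where "minus_free_lie x y = x + - y"

instance
proof
  fix x y z :: "('a, 'b) free_lie"
  show "x + y + z = x + (y + z)" by transfer (rule lie_eq.add_assoc)
  show "x + y = y + x" by transfer (rule lie_eq.add_comm)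
  show "0 + x = x" by transfer (rule lie_eq.add_zero)
  show "- x + x = 0" by transfer (rule lie_eq.add_neg)
  show "x - y = x + - y" by (rule minus_free_lie_def)
qed

end

lift_definition free_scale :: "'p::field \<Rightarrow> ('p, 'x) free_lie \<Rightarrow> ('p, 'x) free_lie"
  is TScale by (rule lie_eq.cong_scale)

lift_definition free_bracket ::
  "('p::field, 'x) free_lie \<Rightarrow> ('p, 'x) free_lie \<Rightarrow> ('p, 'x) free_lie"
  is TBracket by (rule lie_eq.cong_bracket)

lift_definition free_gen :: "'x \<Rightarrow> ('p::field, 'x) free_lie" is TGen .

interpretation free_lie: lie_algebra free_scale free_bracket
proof
  fix a b :: 'a and x y z :: "('a, 'b) free_lie"
  show "free_scale a (x + y) = free_scale a x + free_scale a y"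
    by transfer (rule lie_eq.scale_add)
  show "free_scale (a + b) x = free_scale a x + free_scale b x"
    by transfer (rule lie_eq.add_scale)
  show "free_scale a (free_scale b x) = free_scale (a * b) x"
    by transfer (rule lie_eq.scale_scale)
  show "free_scale 1 x = x"
    by transfer (rule lie_eq.scale_one)
  show "free_bracket (x + y) z = free_bracket x z + free_bracket y z"
    by transfer (rule lie_eq.br_add_left)
  show "free_bracket x (y + z) = free_bracket x y + free_bracket x z"
    by transfer (rule lie_eq.br_add_right)
  show "free_bracket (free_scale a x) y = free_scale a (free_bracket x y)"
    by transfer (rule lie_eq.br_scale_left)
  show "free_bracket x (free_scale a y) = free_scale a (free_bracket x y)"
    by transfer (rule lie_eq.br_scale_right)
  show "free_bracket x x = 0"
    by transfer (rule lie_eq.br_self)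
  show "free_bracket x (free_bracket y z) + free_bracket y (free_bracket z x) +
      free_bracket z (free_bracket x y) = 0"
    by transfer (rule lie_eq.br_jacobi)
qed

text \<open>The universal property: every map from the generators to a Lie algebra extends uniquely
  to a homomorphism.\<close>

primrec term_extend ::
  "('p::field \<Rightarrow> 'l::ab_group_add \<Rightarrow> 'l) \<Rightarrow> ('l \<Rightarrow> 'l \<Rightarrow> 'l) \<Rightarrow> ('x \<Rightarrow> 'l) \<Rightarrow> ('p, 'x) lie_term \<Rightarrow> 'l"
  where
    "term_extend s b g (TGen x) = g x"
  | "term_extend s b g TZero = 0"
  | "term_extend s b g (TAdd t u) = term_extend s b g t + term_extend s b g u"
  | "term_extend s b g (TNeg t) = - term_extend s b g t"
  | "term_extend s b g (TScale a t) = s a (term_extend s b g t)"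
  | "term_extend s b g (TBracket t u) = b (term_extend s b g t) (term_extend s b g u)"

lemma (in lie_algebra) term_extend_cong:
  "lie_eq t u \<Longrightarrow> term_extend scale bracket g t = term_extend scale bracket g u"
  by (induction rule: lie_eq.induct)
    (simp_all add: algebra_simps scale_right_distrib scale_left_distrib bracket_add_left
      bracket_add_right bracket_scale_left bracket_scale_right bracket_self,
     metis add.assoc jacobi)

lemma free_lie_induct [case_names gen zero add neg scale bracket]:
  fixes P :: "('p::field, 'x) free_lie \<Rightarrow> bool"
  assumes gen: "\<And>x. P (free_gen x)"
    and zero: "P 0"
    and add: "\<And>u v. P u \<Longrightarrow> P v \<Longrightarrow> P (u + v)"
    and neg: "\<And>u. P u \<Longrightarrow> P (- u)"
    and scale: "\<And>a u. P u \<Longrightarrow> P (free_scale a u)"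
    and bracket: "\<And>u v. P u \<Longrightarrow> P v \<Longrightarrow> P (free_bracket u v)"
  shows "P u"
proof -
  have "P (abs_free_lie t)" for t
    by (induction t)
      (simp_all add: gen zero add neg scale bracket
        free_gen.abs_eq [symmetric] zero_free_lie.abs_eq [symmetric]
        plus_free_lie.abs_eq [symmetric] uminus_free_lie.abs_eq [symmetric]
        free_scale.abs_eq [symmetric] free_bracket.abs_eq [symmetric])
  then show ?thesis
    by (metis Quotient3_abs_rep Quotient3_free_lie)
qed

theorem (in lie_algebra) free_lie_universal:
  fixes g :: "'x \<Rightarrow> 'l"
  shows "\<exists>!f. lie_hom free_scale free_bracket scale bracket f \<and> (\<forall>x. f (free_gen x) = g x)"
proof (rule ex1I)
  define f where "f u = term_extend scale bracket g (rep_free_lie u)" for u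
  have f_abs: "f (abs_free_lie t) = term_extend scale bracket g t" for t
    unfolding f_def
    by (rule term_extend_cong) (metis Quotient3_free_lie lie_eq.refl rep_abs_rsp_left)
  have abs: "\<exists>t. u = abs_free_lie t" for u :: "('p, 'x) free_lie"
    by (metis Quotient3_abs_rep Quotient3_free_lie)
  have add: "f (u + v) = f u + f v" for u v
    using abs [of u] abs [of v] by (auto simp: f_abs plus_free_lie.abs_eq)
  have scale: "f (free_scale a u) = scale a (f u)" for a u
    using abs [of u] by (auto simp: f_abs free_scale.abs_eq)
  have bracket: "f (free_bracket u v) = bracket (f u) (f v)" for u v
    using abs [of u] abs [of v] by (auto simp: f_abs free_bracket.abs_eq)
  have "Vector_Spaces.linear free_scale scale f"
    by unfold_locales (simp_all add: add scale)
  then show "lie_hom free_scale free_bracket scale bracket f \<and> (\<forall>x. f (free_gen x) = g x)"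
    by (simp add: lie_hom_def bracket f_abs free_gen.abs_eq)
  fix h
  assume h: "lie_hom free_scale free_bracket scale bracket h \<and> (\<forall>x. h (free_gen x) = g x)"
  then interpret h: Vector_Spaces.linear free_scale scale h
    by (simp add: lie_hom_def)
  have "f 0 = 0" "f (- u) = - f u" for u
    using abs [of u] by (auto simp: f_abs zero_free_lie.abs_eq uminus_free_lie.abs_eq)
  then have "h u = f u" for u
    using h by (induction u rule: free_lie_induct)
      (simp_all add: lie_hom_def h.add h.neg h.zero h.scale add scale bracket f_abs free_gen.abs_eq)
  then show "h = f" by (rule ext)
qed


section \<open>Endomorphisms and automorphisms\<close>

definition End_free_lie :: "(('p::field, 'x) free_lie \<Rightarrow> ('p, 'x) free_lie) monoid" where
  "End_free_lie =
    \<lparr>carrier = {\<phi>. lie_hom free_scale free_bracket free_scale free_bracket \<phi>},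
     mult = (\<circ>),
     one = id\<rparr>"

abbreviation Aut_free_lie :: "(('p::field, 'x) free_lie \<Rightarrow> ('p, 'x) free_lie) monoid" where
  "Aut_free_lie \<equiv> units_of End_free_lie"

lemma monoid_End_free_lie: "monoid (End_free_lie :: (('p::field, 'x) free_lie \<Rightarrow> _) monoid)"
proof
  show "\<one>\<^bsub>End_free_lie\<^esub> \<in> carrier (End_free_lie :: (('p, 'x) free_lie \<Rightarrow> _) monoid)"
    by (auto simp: End_free_lie_def lie_hom_def intro!: free_lie.linear_id)
qed (auto simp: End_free_lie_def lie_hom_def comp_assoc intro: Vector_Spaces.linear_compose)

text \<open>Automorphisms in \<^const>\<open>auto\<close> are functions on the carrier, represented extensionally
  (i.e. by \<^const>\<open>undefined\<close> outside it). Hence restricting such an automorphism to the group of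
  units is \<^const>\<open>restrict\<close>.\<close>

definition restrict_to_units :: "('a, 'm) monoid_scheme \<Rightarrow> ('a \<Rightarrow> 'a) \<Rightarrow> ('a \<Rightarrow> 'a)" where
  "restrict_to_units G \<Phi> = restrict \<Phi> (Units G)"

abbreviation \<tau> ::
  "((('p::field, 'x) free_lie \<Rightarrow> ('p, 'x) free_lie) \<Rightarrow> (('p, 'x) free_lie \<Rightarrow> ('p, 'x) free_lie)) \<Rightarrow>
   ((('p, 'x) free_lie \<Rightarrow> ('p, 'x) free_lie) \<Rightarrow> (('p, 'x) free_lie \<Rightarrow> ('p, 'x) free_lie))" where
  "\<tau> \<equiv> restrict_to_units End_free_lie"

text \<open>The scalar automorphism \<open>x \<mapsto> a x\<close> (\<open>x \<in> X\<close>), for nonzero \<open>a\<close>, and the inner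
  automorphism of the endomorphism semigroup that it induces.\<close>

definition scalar_aut :: "'p::field \<Rightarrow> ('p, 'x) free_lie \<Rightarrow> ('p, 'x) free_lie" where
  "scalar_aut a = (THE \<phi>. \<phi> \<in> carrier End_free_lie \<and>
     (\<forall>x. \<phi> (free_gen x) = free_scale a (free_gen x)))"

definition inner_scalar_aut ::
  "'p::field \<Rightarrow> (('p, 'x) free_lie \<Rightarrow> ('p, 'x) free_lie) \<Rightarrow> (('p, 'x) free_lie \<Rightarrow> ('p, 'x) free_lie)"
  where
  "inner_scalar_aut a = (\<lambda>\<phi> \<in> carrier End_free_lie.
     scalar_aut a \<otimes>\<^bsub>End_free_lie\<^esub> \<phi> \<otimes>\<^bsub>End_free_lie\<^esub> inv\<^bsub>End_free_lie\<^esub> (scalar_aut a))"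


section \<open>The definitions above are meaningful\<close>

lemma (in monoid) auto_maps_Units:
  assumes "\<Phi> \<in> auto G" shows "\<Phi> ` Units G = Units G"
proof -
  have hom: "\<Phi> \<in> hom G G" and bij: "bij_betw \<Phi> (carrier G) (carrier G)"
    using assms by (auto simp: auto_def Bij_def)
  have cl: "\<Phi> x \<in> carrier G" if "x \<in> carrier G" for x
    using hom that by (auto simp: hom_def)
  have mult: "\<Phi> (x \<otimes> y) = \<Phi> x \<otimes> \<Phi> y" if "x \<in> carrier G" "y \<in> carrier G" for x y
    using hom that by (auto simp: hom_def)
  have surj: "\<exists>x\<in>carrier G. y = \<Phi> x" if "y \<in> carrier G" for y
    using bij that by (auto simp: bij_betw_def)
  have one: "\<Phi> \<one> = \<one>"
  proof -
    obtain e where e: "e \<in> carrier G" "\<Phi> e = \<one>" using surj [OF one_closed] by metis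
    have "\<Phi> \<one> = \<Phi> \<one> \<otimes> \<Phi> e" using e cl by (metis one_closed r_one)
    also have "\<dots> = \<Phi> (\<one> \<otimes> e)" using e(1) mult [of \<one> e] by (simp del: l_one)
    also have "\<dots> = \<one>" using e by simp
    finally show ?thesis .
  qed
  show ?thesis
  proof (intro equalityI subsetI)
    fix y assume "y \<in> \<Phi> ` Units G"
    then show "y \<in> Units G"
      unfolding Units_def by (auto simp: cl) (metis cl mult one)
  next
    fix y assume y: "y \<in> Units G"
    then obtain z where z: "z \<in> carrier G" "z \<otimes> y = \<one>" "y \<otimes> z = \<one>"
      by (auto simp: Units_def)
    obtain x w where xw: "x \<in> carrier G" "y = \<Phi> x" "w \<in> carrier G" "z = \<Phi> w"
      using surj y z(1) by (metis Units_closed)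
    have "\<Phi> (w \<otimes> x) = \<Phi> \<one>" "\<Phi> (x \<otimes> w) = \<Phi> \<one>"
      using z xw by (simp_all add: mult one)
    then have "w \<otimes> x = \<one>" "x \<otimes> w = \<one>"
      using bij xw by (auto simp: bij_betw_def inj_on_def)
    then show "y \<in> \<Phi> ` Units G" using xw by (auto simp: Units_def)
  qed
qed

lemma (in monoid) restrict_to_units_hom:
  "restrict_to_units G \<in> hom (AutoGroup G) (AutoGroup (units_of G))"
proof -
  have in_auto: "restrict \<Phi> (Units G) \<in> auto (units_of G)" if \<Phi>: "\<Phi> \<in> auto G" for \<Phi>
  proof -
    have "\<Phi> \<in> hom G G" "inj_on \<Phi> (carrier G)"
      using \<Phi> by (auto simp: auto_def Bij_def bij_betw_def)
    moreover have "\<Phi> ` Units G = Units G" by (rule auto_maps_Units [OF \<Phi>])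
    moreover have "inj_on \<Phi> (Units G)"
      using calculation(2) by (rule inj_on_subset) (auto simp: Units_def)
    ultimately show ?thesis
      by (auto simp: auto_def Bij_def hom_def units_of_carrier units_of_mult bij_betw_def
          inj_on_restrict_eq Units_closed Pi_iff)
  qed
  moreover have "restrict (compose (carrier G) \<Phi> \<Psi>) (Units G) =
      compose (Units G) (restrict \<Phi> (Units G)) (restrict \<Psi> (Units G))"
    if "\<Phi> \<in> auto G" "\<Psi> \<in> auto G" for \<Phi> \<Psi>
    using auto_maps_Units [OF that(2)] by (auto simp: compose_def fun_eq_iff)
  ultimately show ?thesis
    by (auto simp: hom_def restrict_to_units_def AutoGroup_def BijGroup_def units_of_carrier)
      (auto simp: auto_def units_of_carrier)
qed

lemma End_free_lie_eqI:
  fixes \<phi> \<psi> :: "('p::field, 'x) free_lie \<Rightarrow> ('p, 'x) free_lie"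
  assumes "\<phi> \<in> carrier End_free_lie" "\<psi> \<in> carrier End_free_lie"
    and "\<And>x. \<phi> (free_gen x) = \<psi> (free_gen x)"
  shows "\<phi> = \<psi>"
  using free_lie.free_lie_universal [of "\<lambda>x. \<psi> (free_gen x)"] assms
  unfolding End_free_lie_def by auto

lemma scalar_aut:
  fixes a :: "'p::field"
  shows "(scalar_aut a :: ('p, 'x) free_lie \<Rightarrow> _) \<in> carrier End_free_lie \<and>
    (\<forall>x::'x. scalar_aut a (free_gen x) = free_scale a (free_gen x))"
proof -
  have "\<exists>!\<phi>. \<phi> \<in> carrier End_free_lie \<and>
      (\<forall>x. \<phi> (free_gen x) = free_scale a (free_gen x :: ('p, 'x) free_lie))"
    using free_lie.free_lie_universal [of "\<lambda>x::'x. free_scale a (free_gen x)"]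
    by (simp add: End_free_lie_def)
  from theI' [OF this] show ?thesis unfolding scalar_aut_def .
qed

lemma scalar_aut_End: "scalar_aut a \<in> carrier End_free_lie"
  and scalar_aut_gen: "scalar_aut a (free_gen x) = free_scale a (free_gen x)"
  by (simp_all add: scalar_aut)

lemma scalar_aut_in_Aut:
  fixes a :: "'p::field"
  assumes "a \<noteq> 0"
  shows "(scalar_aut a :: ('p, 'x) free_lie \<Rightarrow> _) \<in> carrier Aut_free_lie"
proof -
  interpret E: monoid "End_free_lie :: (('p, 'x) free_lie \<Rightarrow> _) monoid"
    by (rule monoid_End_free_lie)
  have scale: "scalar_aut b (free_scale c u) = free_scale c (scalar_aut b u)"
    for b c and u :: "('p, 'x) free_lie"
    using scalar_aut_End [of b, where ?'b = 'x]
    by (auto simp: End_free_lie_def lie_hom_def Vector_Spaces.linear_iff)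
  have "scalar_aut b \<otimes>\<^bsub>End_free_lie\<^esub> scalar_aut c =
      (\<one>\<^bsub>End_free_lie\<^esub> :: ('p, 'x) free_lie \<Rightarrow> _)" if "b * c = 1" for b c
  proof (rule End_free_lie_eqI)
    show "(scalar_aut b \<otimes>\<^bsub>End_free_lie\<^esub> scalar_aut c) (free_gen x) =
        (\<one>\<^bsub>End_free_lie\<^esub> :: ('p, 'x) free_lie \<Rightarrow> _) (free_gen x)" for x
      using that
      by (simp add: End_free_lie_def scalar_aut_gen scale free_lie.scale_scale mult.commute)
  qed (intro E.m_closed scalar_aut_End E.one_closed)+
  from this [of a "inverse a"] this [of "inverse a" a] assms show ?thesis
    unfolding units_of_carrier Units_def using scalar_aut_End by auto
qed

end

theory Submission
  imports Defs "HOL-Library.Poly_Mapping" "HOL-Computational_Algebra.Polynomial"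
begin

text \<open>
  Write \<open>F\<close> for the free Lie algebra on \<open>x, y\<close> and \<open>A\<close> for the free associative algebra on
  \<open>x, y\<close>. The two inclusions rest on different facts.

  \<^emph>\<open>Each conjugation by a scalar automorphism restricts to the identity on \<open>Aut(F)\<close>.\<close> This says
  that scalar automorphisms commute with all automorphisms, which holds because automorphisms of \<open>F\<close>
  are linear in rank two (\<open>automorphism_linear\<close>). Let \<open>u, v\<close> be the images of \<open>x, y\<close> in \<open>A\<close> under
  an automorphism. Since the automorphism is onto, the right ideal \<open>uA + vA\<close> contains \<open>x\<close> and \<open>y\<close>.
  If \<open>deg v \<ge> 2\<close> and \<open>deg u \<le> deg v\<close>, then writing \<open>x\<close> and \<open>y\<close> in the form \<open>ua + vb\<close> forces a
  cancellation of top components in one of the two, and comparison of coefficients shows that the top component of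
  \<open>v\<close> is a right multiple of that of \<open>u\<close> (\<open>top_component_right_multiple\<close>). But a Lie element that is
  a right multiple of a nonzero Lie element \<open>u\<close> is a scalar multiple of \<open>u\<close>
  (\<open>right_multiple_of_lie_element\<close>), so subtracting a multiple of \<open>u\<close> from \<open>v\<close> lowers the degree.
  Iteration reduces to degree one.

  The statement on right multiples, as well as the injectivity of \<open>F \<rightarrow> A\<close>, comes from the
  Poincare-Birkhoff-Witt theorem, in the form that a Lie algebra with an ordered basis \<open>B\<close> acts on
  the space spanned by the ordered monomials over \<open>B\<close> in such a way that \<open>b\<close> takes a monomial \<open>M\<close>
  with \<open>b \<le> M\<close> to \<open>b M\<close>. If \<open>u\<close> is the least element of \<open>B\<close>, then the image of \<open>u\<close> consists of
  combinations of monomials beginning with \<open>u\<close>, whereas an element \<open>v\<close> takes the empty monomial to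
  the expansion of \<open>v\<close> in the basis. This argument is independent of the characteristic.

  \<^emph>\<open>Each automorphism \<open>\<Phi>\<close> of \<open>End(F)\<close> fixing \<open>Aut(F)\<close> is such a conjugation.\<close> Here only the
  invertible linear substitutions are used. Because \<open>\<Phi>\<close> fixes the diagonal automorphisms, it fixes
  the idempotent \<open>x \<mapsto> x, y \<mapsto> 0\<close>. Hence \<open>\<Phi>\<close> takes the endomorphism \<open>x \<mapsto> u, y \<mapsto> 0\<close> to
  \<open>x \<mapsto> s(u), y \<mapsto> 0\<close> for an injective map \<open>s\<close> of \<open>F\<close> into itself, and \<open>\<Phi>(\<phi>) \<circ> s = s \<circ> \<phi>\<close>. The
  values of \<open>s\<close> at \<open>x\<close>, \<open>y\<close>, \<open>x + y\<close> and \<open>\<alpha> x\<close> are determined by equivariance under \<open>Aut(F)\<close>; they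
  show that \<open>s\<close> is linear. The value at \<open>[x, y]\<close> has weight \<open>(1, 1)\<close> under the diagonal
  automorphisms, and is therefore \<open>a [x, y]\<close>, as the field is infinite. Substitution gives
  \<open>s [u, v] = a [s u, s v]\<close>, so that \<open>a s\<close> is the scalar automorphism \<open>f\<^sub>a\<close>, and \<open>\<Phi>\<close> is conjugation
  by \<open>f\<^sub>a\<close>.
\<close>

section \<open>Finitely supported functions as a vector space\<close>

abbreviation lookup :: "('k \<Rightarrow>\<^sub>0 'a::zero) \<Rightarrow> 'k \<Rightarrow> 'a" where
  "lookup \<equiv> Poly_Mapping.lookup"

abbreviation keys :: "('k \<Rightarrow>\<^sub>0 'a::zero) \<Rightarrow> 'k set" where
  "keys \<equiv> Poly_Mapping.keys"

text \<open>Pointwise scalar multiplication. It serves both the free associative algebra (finitely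
  supported functions on words) and the module of ordered monomials.\<close>

definition psc :: "'p::field \<Rightarrow> ('k \<Rightarrow>\<^sub>0 'p) \<Rightarrow> ('k \<Rightarrow>\<^sub>0 'p)" where
  "psc c p = Poly_Mapping.map ((*) c) p"

lemma lookup_psc [simp]: "lookup (psc c p) k = c * lookup p k"
  by (simp add: psc_def Poly_Mapping.map.rep_eq when_def)

global_interpretation pm: vector_space psc
  by unfold_locales (auto intro!: poly_mapping_eqI simp: lookup_add algebra_simps)

lemma psc_single [simp]: "psc c (Poly_Mapping.single k d) = Poly_Mapping.single k (c * d)"
  by (rule poly_mapping_eqI) (simp add: lookup_single when_def)

text \<open>The functions whose support lies in \<open>K\<close>.\<close>

definition supported :: "'k set \<Rightarrow> ('k \<Rightarrow>\<^sub>0 'p::field) set" where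
  "supported K = {p. keys p \<subseteq> K}"

lemma supported_iff: "p \<in> supported K \<longleftrightarrow> (\<forall>k. lookup p k \<noteq> 0 \<longrightarrow> k \<in> K)"
  by (auto simp: supported_def in_keys_iff)

lemma subspace_supported: "pm.subspace (supported K)"
  by (rule pm.subspaceI) (auto simp: supported_iff lookup_add, metis add.right_neutral)

lemma single_supported: "k \<in> K \<Longrightarrow> Poly_Mapping.single k c \<in> supported K"
  by (auto simp: supported_iff lookup_single when_def)

text \<open>The linear extension of a map defined on the basis of point masses.\<close>

definition lin :: "('k \<Rightarrow> ('m \<Rightarrow>\<^sub>0 'p)) \<Rightarrow> ('k \<Rightarrow>\<^sub>0 'p) \<Rightarrow> ('m \<Rightarrow>\<^sub>0 'p::field)" where
  "lin f p = (\<Sum>k\<in>keys p. psc (lookup p k) (f k))"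

lemma lin_superset:
  assumes "finite K" "keys p \<subseteq> K"
  shows "lin f p = (\<Sum>k\<in>K. psc (lookup p k) (f k))"
  unfolding lin_def using assms by (intro sum.mono_neutral_left) (auto simp: in_keys_iff)

lemma lin_add: "lin f (p + q) = lin f p + lin f q"
proof -
  let ?K = "keys p \<union> keys q"
  have "keys (p + q) \<subseteq> ?K" by (rule Poly_Mapping.keys_add)
  then show ?thesis
    by (simp add: lin_superset[of ?K] lookup_add pm.scale_left_distrib sum.distrib)
qed

lemma lin_psc: "lin f (psc c p) = psc c (lin f p)"
proof -
  have "keys (psc c p) \<subseteq> keys p" by (auto simp: in_keys_iff)
  then show ?thesis
    by (simp add: lin_superset[of "keys p"] pm.scale_sum_right)
qed

lemma lin_single [simp]: "lin f (Poly_Mapping.single k c) = psc c (f k)"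
  by (subst lin_superset[of "{k}"]) auto

lemma linear_lin: "Vector_Spaces.linear psc psc (lin f)"
  by unfold_locales (auto simp: lin_add lin_psc)

lemma lin_cong: "(\<And>k. k \<in> keys p \<Longrightarrow> f k = g k) \<Longrightarrow> lin f p = lin g p"
  by (simp add: lin_def)

lemma lin_in_subspace:
  assumes "pm.subspace V" "\<And>k. k \<in> keys p \<Longrightarrow> f k \<in> V"
  shows "lin f p \<in> V"
  unfolding lin_def using assms by (intro pm.subspace_sum pm.subspace_scale) auto

lemma lin_basis: "lin (\<lambda>k. Poly_Mapping.single k 1) p = p"
proof (rule poly_mapping_eqI)
  fix k
  show "lookup (lin (\<lambda>k. Poly_Mapping.single k 1) p) k = lookup p k"
    by (simp add: lin_def lookup_sum lookup_single when_def sum.delta' in_keys_iff)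
qed

lemma linear_ext:
  fixes p :: "'k \<Rightarrow>\<^sub>0 'p::field" and f g :: "('k \<Rightarrow>\<^sub>0 'p) \<Rightarrow> ('m \<Rightarrow>\<^sub>0 'p)"
  assumes f: "Vector_Spaces.linear psc psc f" and g: "Vector_Spaces.linear psc psc g"
    and eq: "\<And>k. k \<in> keys p \<Longrightarrow> f (Poly_Mapping.single k 1) = g (Poly_Mapping.single k 1)"
  shows "f p = g p"
proof -
  interpret f: Vector_Spaces.linear psc psc f by (rule f)
  interpret g: Vector_Spaces.linear psc psc g by (rule g)
  have p: "p = (\<Sum>k\<in>keys p. psc (lookup p k) (Poly_Mapping.single k 1))"
    using lin_basis[of p] by (simp add: lin_def)
  show ?thesis
    by (subst (1 2) p) (simp only: f.sum f.scale g.sum g.scale eq cong: sum.cong)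
qed

section \<open>The Poincare-Birkhoff-Witt module\<close>

text \<open>A Lie algebra with a linearly ordered basis. The order is given on the whole space.\<close>

locale ordered_lie_algebra = lie_algebra scale bracket
  for scale :: "'p::field \<Rightarrow> 'l::ab_group_add \<Rightarrow> 'l" and bracket :: "'l \<Rightarrow> 'l \<Rightarrow> 'l" +
  fixes B :: "'l set" and le :: "'l \<Rightarrow> 'l \<Rightarrow> bool"
  assumes independent_B: "independent B" and span_B: "span B = UNIV"
    and le_total: "le a b \<or> le b a"
    and le_trans: "le a b \<Longrightarrow> le b c \<Longrightarrow> le a c"
    and le_antisym: "le a b \<Longrightarrow> le b a \<Longrightarrow> a = b"
begin

sublocale SP: vector_space_pair scale psc ..

abbreviation z :: "'l list \<Rightarrow> 'l list \<Rightarrow>\<^sub>0 'p" where "z M \<equiv> Poly_Mapping.single M 1"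

text \<open>Ordered monomials: weakly increasing lists of basis elements. The vector \<open>z M\<close> is the basis
  vector of the module that belongs to \<open>M\<close>.\<close>

definition mon :: "'l list \<Rightarrow> bool" where
  "mon M \<longleftrightarrow> sorted_wrt le M \<and> set M \<subseteq> B"

text \<open>Insertion into a list at the position prescribed by the order; the monomial \<open>ins b M\<close> is the
  commutative product of \<open>b\<close> and \<open>M\<close>.\<close>

primrec ins :: "'l \<Rightarrow> 'l list \<Rightarrow> 'l list" where
  "ins b [] = [b]"
| "ins b (c # N) = (if le b c then b # c # N else c # ins b N)"

lemma length_ins [simp]: "length (ins b M) = Suc (length M)"
  by (induction M) auto

lemma set_ins [simp]: "set (ins b M) = insert b (set M)"
  by (induction M) auto

lemma mon_ins: "mon M \<Longrightarrow> b \<in> B \<Longrightarrow> mon (ins b M)"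
  by (induction M) (auto simp: mon_def intro: le_trans, use le_total in blast)

lemma ins_le: "\<forall>c\<in>set M. le b c \<Longrightarrow> ins b M = b # M"
  by (cases M) auto

text \<open>The linear extension of \<open>f\<close> from the basis \<open>B\<close>, evaluated at \<open>y\<close>.\<close>

abbreviation comb :: "'l \<Rightarrow> ('l \<Rightarrow> 'l list \<Rightarrow>\<^sub>0 'p) \<Rightarrow> 'l list \<Rightarrow>\<^sub>0 'p" where
  "comb y f \<equiv> SP.construct B f y"

lemma comb_in_subspace:
  assumes "pm.subspace V" "\<And>b. b \<in> B \<Longrightarrow> f b \<in> V"
  shows "comb y f \<in> V"
proof -
  have "pm.span (f ` B) \<subseteq> V" using assms by (intro pm.span_minimal) auto
  then show ?thesis using SP.construct_in_span[OF independent_B, of f y] by blast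
qed

text \<open>The action of \<open>b\<close> on a monomial \<open>M\<close> is to be \<open>z (ins b M)\<close> plus a correction of length at most
  that of \<open>M\<close>, and the correction is forced by the rule \<open>b (c N) = c (b N) + [b, c] N\<close> for \<open>c < b\<close>. The
  recursion passes through the monomials in the support of a correction already computed; the
  first argument of \<open>R\<close> bounds its depth, and any value that is at least the length of \<open>M\<close> gives the
  same result (\<open>R_stable\<close>).\<close>

primrec R :: "nat \<Rightarrow> 'l \<Rightarrow> 'l list \<Rightarrow> 'l list \<Rightarrow>\<^sub>0 'p" where
  "R 0 b M = 0"
| "R (Suc n) b M = (case M of [] \<Rightarrow> 0 | c # N \<Rightarrow>
     if le b c then 0
     else lin (\<lambda>M'. z (ins c M') + R n c M') (R n b N) + comb (bracket b c) (\<lambda>d. z (ins d N) + R n d N))"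

lemma R_length: "R n b M \<in> supported {M'. length M' \<le> length M}"
proof (induction n arbitrary: b M)
  case 0
  then show ?case by (simp add: pm.subspace_0[OF subspace_supported])
next
  case (Suc n)
  show ?case
  proof (cases M)
    case Nil
    then show ?thesis by (simp add: pm.subspace_0[OF subspace_supported])
  next
    case (Cons c N)
    let ?V = "supported {M'. length M' \<le> length M} :: ('l list \<Rightarrow>\<^sub>0 'p) set"
    have *: "z (ins d M') + R n d M' \<in> ?V" if "length M' \<le> length N" for d M'
      using Suc[of d M'] that Cons
      by (intro pm.subspace_add[OF subspace_supported] single_supported) (auto simp: supported_def)
    have "lin (\<lambda>M'. z (ins c M') + R n c M') (R n b N) \<in> ?V"
      using Suc[of b N] by (intro lin_in_subspace[OF subspace_supported] *) (auto simp: supported_def)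
    moreover have "comb (bracket b c) (\<lambda>d. z (ins d N) + R n d N) \<in> ?V"
      by (intro comb_in_subspace[OF subspace_supported] *) auto
    ultimately show ?thesis
      by (auto simp: Cons pm.subspace_0[OF subspace_supported] pm.subspace_add[OF subspace_supported])
  qed
qed

lemma R_mon: "b \<in> B \<Longrightarrow> mon M \<Longrightarrow> R n b M \<in> supported {M'. mon M'}"
proof (induction n arbitrary: b M)
  case 0
  then show ?case by (simp add: pm.subspace_0[OF subspace_supported])
next
  case (Suc n)
  show ?case
  proof (cases M)
    case Nil
    then show ?thesis by (simp add: pm.subspace_0[OF subspace_supported])
  next
    case (Cons c N)
    let ?V = "supported {M'. mon M'} :: ('l list \<Rightarrow>\<^sub>0 'p) set"
    have cN: "c \<in> B" "mon N" using Suc.prems Cons by (auto simp: mon_def)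
    have *: "z (ins d M') + R n d M' \<in> ?V" if "mon M'" "d \<in> B" for d M'
      using Suc.IH[of d M'] that
      by (intro pm.subspace_add[OF subspace_supported] single_supported) (auto simp: mon_ins)
    have "lin (\<lambda>M'. z (ins c M') + R n c M') (R n b N) \<in> ?V"
      using Suc.IH[of b N] cN Suc.prems(1)
      by (intro lin_in_subspace[OF subspace_supported] *) (auto simp: supported_def)
    moreover have "comb (bracket b c) (\<lambda>d. z (ins d N) + R n d N) \<in> ?V"
      by (intro comb_in_subspace[OF subspace_supported] * cN) auto
    ultimately show ?thesis
      by (auto simp: Cons pm.subspace_0[OF subspace_supported] pm.subspace_add[OF subspace_supported])
  qed
qed

lemma R_stable: "length M \<le> n \<Longrightarrow> length M \<le> m \<Longrightarrow> R n b M = R m b M"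
proof (induction n arbitrary: m b M)
  case 0
  then show ?case by (cases m) auto
next
  case (Suc n)
  show ?case
  proof (cases M)
    case Nil
    then show ?thesis by (cases m) auto
  next
    case (Cons c N)
    then obtain m' where m: "m = Suc m'" using Suc.prems by (cases m) auto
    have eq: "R n d M' = R m' d M'" if "length M' \<le> length N" for d M'
      using that Suc.prems Cons m by (intro Suc.IH) auto
    have "lin (\<lambda>M'. z (ins c M') + R n c M') (R m' b N) = lin (\<lambda>M'. z (ins c M') + R m' c M') (R m' b N)"
      using R_length[of m' b N] by (intro lin_cong) (auto simp: supported_def eq)
    then show ?thesis by (simp add: Cons m eq)
  qed
qed

text \<open>The action of a basis element on the module of monomials.\<close>

definition act :: "'l \<Rightarrow> ('l list \<Rightarrow>\<^sub>0 'p) \<Rightarrow> ('l list \<Rightarrow>\<^sub>0 'p)" where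
  "act b = lin (\<lambda>M. z (ins b M) + R (length M) b M)"

lemma linear_act: "Vector_Spaces.linear psc psc (act b)"
  unfolding act_def by (rule linear_lin)

lemma act_z: "act b (z M) = z (ins b M) + R (length M) b M"
  by (simp add: act_def)

lemma act_z_le: "\<forall>c\<in>set M. le b c \<Longrightarrow> act b (z M) = z (b # M)"
proof -
  assume le: "\<forall>c\<in>set M. le b c"
  then have "R (length M) b M = 0" by (cases M) auto
  with le show ?thesis by (simp add: act_z ins_le)
qed

text \<open>The action of an arbitrary element of the Lie algebra, linear in both arguments.\<close>

definition mod_act :: "'l \<Rightarrow> ('l list \<Rightarrow>\<^sub>0 'p) \<Rightarrow> ('l list \<Rightarrow>\<^sub>0 'p)" where
  "mod_act y s = comb y (\<lambda>b. act b s)"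

lemma mod_act_basis: "b \<in> B \<Longrightarrow> mod_act b s = act b s"
  unfolding mod_act_def by (rule SP.construct_basis[OF independent_B])

lemma linear_mod_act_left: "Vector_Spaces.linear scale psc (\<lambda>y. mod_act y s)"
  unfolding mod_act_def by (rule SP.linear_construct[OF independent_B])

lemma linear_mod_act_right: "Vector_Spaces.linear psc psc (mod_act y)"
proof -
  interpret a: Vector_Spaces.linear psc psc "act b" for b by (rule linear_act)
  show ?thesis
    unfolding mod_act_def
    by unfold_locales (simp_all add: a.add a.scale SP.construct_add[OF independent_B]
        SP.construct_scale[OF independent_B])
qed

interpretation al: Vector_Spaces.linear scale psc "\<lambda>y. mod_act y s" for s by (rule linear_mod_act_left)
interpretation ar: Vector_Spaces.linear psc psc "mod_act y" for y by (rule linear_mod_act_right)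

text \<open>The span of the ordered monomials of length at most \<open>n\<close>.\<close>

definition Sp :: "nat \<Rightarrow> ('l list \<Rightarrow>\<^sub>0 'p) set" where
  "Sp n = supported {M. mon M \<and> length M \<le> n}"

text \<open>The rule that defines the correction, as an identity between actions.\<close>

lemma mod_act_step:
  assumes b: "b \<in> B" and M: "mon (c # N)" and nle: "\<not> le b c"
  shows "mod_act b (z (c # N)) = mod_act c (mod_act b (z N)) + mod_act (bracket b c) (z N)"
proof -
  have c: "c \<in> B" and cN: "\<forall>d\<in>set N. le c d" using M by (auto simp: mon_def)
  have cb: "le c b" using nle le_total by blast
  interpret ac: Vector_Spaces.linear psc psc "act c" by (rule linear_act)
  let ?f = "\<lambda>M'. z (ins c M') + R (length N) c M'"
  have "act c (z (ins b N)) = z (c # ins b N)"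
    using cb cN by (intro act_z_le) auto
  moreover have "act c (R (length N) b N) = lin ?f (R (length N) b N)"
    unfolding act_def using R_length[of "length N" b N]
    by (intro lin_cong) (auto simp: supported_def intro!: R_stable)
  moreover have "mod_act (bracket b c) (z N) = comb (bracket b c) (\<lambda>d. z (ins d N) + R (length N) d N)"
    by (simp add: mod_act_def act_z)
  ultimately show ?thesis
    using nle by (simp add: mod_act_basis b c act_z ac.add)
qed

lemma R_in_Sp: 
  assumes "b \<in> B" "mon M" shows "R (length M) b M \<in> Sp (length M)"
  using R_length[of "length M" b M] R_mon[OF assms] by (auto simp: Sp_def supported_def)

text \<open>By bilinearity the commutation relation on monomials of length at most \<open>n\<close>, for basis
  elements, extends to the span of these monomials and to all elements of the Lie algebra.\<close>

lemma mod_act_commutator_Sp: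
  assumes base: "\<And>a b M. a \<in> B \<Longrightarrow> b \<in> B \<Longrightarrow> mon M \<Longrightarrow> length M \<le> n \<Longrightarrow>
      mod_act a (mod_act b (z M)) - mod_act b (mod_act a (z M)) = mod_act (bracket a b) (z M)"
    and s: "s \<in> Sp n"
  shows "mod_act x (mod_act y s) - mod_act y (mod_act x s) = mod_act (bracket x y) s"
proof -
  have basis: "mod_act a (mod_act b s) - mod_act b (mod_act a s) = mod_act (bracket a b) s"
    if "a \<in> B" "b \<in> B" for a b
  proof (rule linear_ext[where f = "\<lambda>s. mod_act a (mod_act b s) - mod_act b (mod_act a s)"])
    show "Vector_Spaces.linear psc psc (\<lambda>s. mod_act a (mod_act b s) - mod_act b (mod_act a s))"
      by unfold_locales (simp_all add: ar.add ar.scale pm.scale_right_diff_distrib)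
    show "Vector_Spaces.linear psc psc (mod_act (bracket a b))" by (rule linear_mod_act_right)
    fix M assume "M \<in> keys s"
    then show "mod_act a (mod_act b (z M)) - mod_act b (mod_act a (z M)) = mod_act (bracket a b) (z M)"
      using s that by (intro base) (auto simp: Sp_def supported_def)
  qed
  have left: "mod_act a (mod_act y s) - mod_act y (mod_act a s) = mod_act (bracket a y) s"
    if "a \<in> B" for a y
  proof (rule SP.linear_eq_on_span[where B = B and f = "\<lambda>y. mod_act a (mod_act y s) - mod_act y (mod_act a s)"])
    show "Vector_Spaces.linear scale psc (\<lambda>y. mod_act a (mod_act y s) - mod_act y (mod_act a s))"
      by unfold_locales (simp_all add: al.add ar.add al.scale ar.scale pm.scale_right_diff_distrib)
    show "Vector_Spaces.linear scale psc (\<lambda>y. mod_act (bracket a y) s)"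
      by unfold_locales (simp_all add: al.add bracket_add_right al.scale bracket_scale_right)
  qed (use that basis span_B in auto)
  show ?thesis
  proof (rule SP.linear_eq_on_span[where B = B and f = "\<lambda>x. mod_act x (mod_act y s) - mod_act y (mod_act x s)"])
    show "Vector_Spaces.linear scale psc (\<lambda>x. mod_act x (mod_act y s) - mod_act y (mod_act x s))"
      by unfold_locales (simp_all add: al.add ar.add al.scale ar.scale pm.scale_right_diff_distrib)
    show "Vector_Spaces.linear scale psc (\<lambda>x. mod_act (bracket x y) s)"
      by unfold_locales (simp_all add: al.add bracket_add_left al.scale bracket_scale_left)
  qed (use left span_B in auto)
qed

lemma bracket_antisym: "bracket x y = - bracket y x"
proof -
  have "bracket x y + bracket y x = bracket (x + y) (x + y)"
    unfolding bracket_add_left bracket_add_right by (simp add: bracket_self)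
  then have "bracket x y + bracket y x = 0"
    by (simp only: bracket_self)
  then show ?thesis by (simp add: eq_neg_iff_add_eq_0)
qed

lemma jacobi': "bracket x (bracket y w) - bracket y (bracket x w) = bracket (bracket x y) w"
proof -
  have "bracket x (bracket y w) + bracket y (bracket w x) + bracket w (bracket x y) = 0"
    by (rule jacobi)
  moreover have "bracket y (bracket w x) = - bracket y (bracket x w)"
    using bracket_antisym[of w x] bracket_scale_right[of y "-1" "bracket x w"] by simp
  ultimately show ?thesis
    using bracket_antisym[of w "bracket x y"] by (simp add: algebra_simps)
qed

text \<open>The commutation relation, by induction on the length of the monomial. If \<open>a\<close> or \<open>b\<close> may be
  placed in front of the monomial, the relation is \<open>mod_act_step\<close>. Otherwise the monomial begins
  with some \<open>c\<close> smaller than both; then \<open>a\<close> and \<open>b\<close> are moved past \<open>c\<close>, and the difference of the two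
  results is settled by the Jacobi identity and the induction hypothesis.\<close>

lemma mod_act_commutator_z:
  assumes "a \<in> B" "b \<in> B" "mon T"
  shows "mod_act a (mod_act b (z T)) - mod_act b (mod_act a (z T)) = mod_act (bracket a b) (z T)"
  using assms
proof (induction "length T" arbitrary: a b T rule: less_induct)
  case less
  note a = less.prems(1) and b = less.prems(2) and T = less.prems(3)
  have easy: "mod_act a (mod_act b (z T)) - mod_act b (mod_act a (z T)) = mod_act (bracket a b) (z T)"
    if a: "a \<in> B" and b: "b \<in> B" and nle: "\<not> le a b" and bT: "\<forall>c\<in>set T. le b c" for a b
  proof -
    have "mod_act b (z T) = z (b # T)" using bT b by (simp add: mod_act_basis act_z_le)
    moreover have "mon (b # T)" using T b bT by (auto simp: mon_def)
    ultimately show ?thesis using mod_act_step[OF a _ nle, of T] by simp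
  qed
  have swap: "mod_act (bracket a b) s = - mod_act (bracket b a) s" for a b s
    by (subst bracket_antisym) (simp add: al.neg)
  consider "a = b" | "\<not> le a b" "\<forall>c\<in>set T. le b c" | "\<not> le b a" "\<forall>c\<in>set T. le a c"
    | c N where "T = c # N" "\<not> le a c" "\<not> le b c"
  proof (cases T)
    case Nil
    then show ?thesis using that le_antisym by fastforce
  next
    case (Cons c N)
    then have cN: "\<forall>d\<in>set N. le c d" using T by (simp add: mon_def)
    show ?thesis
    proof (cases "le a c \<or> le b c")
      case True
      then have "a = b \<or> \<not> le a b \<and> (\<forall>c\<in>set T. le b c) \<or> \<not> le b a \<and> (\<forall>c\<in>set T. le a c)"
        using Cons cN le_trans le_antisym le_total by (metis set_ConsD)
      then show ?thesis using that by blast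
    qed (use that Cons in blast)
  qed
  then show ?case
  proof cases
    case 1
    then show ?thesis by (simp add: bracket_self al.zero)
  next
    case 2
    then show ?thesis using easy a b by blast
  next
    case 3
    then show ?thesis using easy[OF b a] swap[of a b] by (simp add: algebra_simps)
  next
    case (4 c N)
    have c: "c \<in> B" and N: "mon N" and cN: "\<forall>d\<in>set N. le c d" using T 4 by (auto simp: mon_def)
    have IH: "mod_act x (mod_act y s) - mod_act y (mod_act x s) = mod_act (bracket x y) s"
      if "s \<in> Sp (length N)" for x y s
      by (rule mod_act_commutator_Sp[OF _ that]) (use less.hyps 4 in auto)
    let ?s = "z N"
    have s: "?s \<in> Sp (length N)" using N by (auto simp: Sp_def intro: single_supported)
    have zT: "z T = mod_act c ?s" using cN c 4 by (simp add: mod_act_basis act_z_le)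
    \<comment> \<open>The term \<open>z (ins b N)\<close> of \<open>b N\<close> is as long as \<open>T\<close>, beyond the reach of the induction
      hypothesis; it is covered by the defining rule, since \<open>c\<close> precedes all its letters.\<close>
    have past_c: "mod_act a (mod_act c (mod_act b ?s))
        = mod_act c (mod_act a (mod_act b ?s)) + mod_act (bracket a c) (mod_act b ?s)"
      if a: "a \<in> B" "\<not> le a c" and b: "b \<in> B" "\<not> le b c" for a b
    proof -
      have eq: "mod_act b ?s = z (ins b N) + R (length N) b N" by (simp add: mod_act_basis b act_z)
      have le: "\<forall>d\<in>set (ins b N). le c d" using cN b le_total by auto
      then have "mod_act c (z (ins b N)) = z (c # ins b N)" by (simp add: mod_act_basis c act_z_le)
      moreover have "mon (c # ins b N)" using mon_ins[OF N b(1)] c le by (simp add: mon_def)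
      ultimately have "mod_act a (mod_act c (z (ins b N)))
          = mod_act c (mod_act a (z (ins b N))) + mod_act (bracket a c) (z (ins b N))"
        using mod_act_step[OF a(1) _ a(2)] by simp
      moreover have "mod_act a (mod_act c (R (length N) b N))
          = mod_act c (mod_act a (R (length N) b N)) + mod_act (bracket a c) (R (length N) b N)"
        using IH[OF R_in_Sp[OF b(1) N], of a c] by (simp add: algebra_simps)
      ultimately show ?thesis by (simp add: eq ar.add)
    qed
    have expand: "mod_act a (mod_act b (z T)) = mod_act c (mod_act a (mod_act b ?s))
        + mod_act (bracket a c) (mod_act b ?s) + mod_act (bracket b c) (mod_act a ?s)
        + mod_act (bracket a (bracket b c)) ?s"
      if a: "a \<in> B" "\<not> le a c" and b: "b \<in> B" "\<not> le b c" for a b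
    proof -
      have "mod_act b (z T) = mod_act c (mod_act b ?s) + mod_act (bracket b c) ?s"
        using mod_act_step[OF b(1) _ b(2), of N] T 4 by simp
      moreover have "mod_act a (mod_act (bracket b c) ?s)
          = mod_act (bracket b c) (mod_act a ?s) + mod_act (bracket a (bracket b c)) ?s"
        using IH[OF s, of a "bracket b c"] by (simp add: algebra_simps)
      ultimately show ?thesis using past_c[OF a b] by (simp add: ar.add)
    qed
    have "mod_act a (mod_act b (z T)) - mod_act b (mod_act a (z T))
        = mod_act c (mod_act a (mod_act b ?s)) - mod_act c (mod_act b (mod_act a ?s))
          + (mod_act (bracket a (bracket b c)) ?s - mod_act (bracket b (bracket a c)) ?s)"
      using expand[of a b] expand[of b a] a b 4 by simp
    also have "\<dots> = mod_act c (mod_act (bracket a b) ?s) + mod_act (bracket (bracket a b) c) ?s"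
      unfolding IH[OF s, of a b, symmetric] ar.diff al.diff[symmetric] jacobi' ..
    also have "\<dots> = mod_act (bracket a b) (mod_act c ?s)"
      using IH[OF s, of "bracket a b" c] by (simp add: algebra_simps)
    finally show ?thesis by (simp add: zT)
  qed
qed

theorem mod_act_bracket:
  assumes "s \<in> supported {M. mon M}"
  shows "mod_act (bracket x y) s = mod_act x (mod_act y s) - mod_act y (mod_act x s)"
proof -
  obtain n where n: "\<forall>M\<in>keys s. length M \<le> n"
    using finite_keys[of s] by (meson finite_imageI finite_nat_set_iff_bounded_le imageI)
  have "s \<in> Sp n" using assms n by (auto simp: Sp_def supported_def)
  then show ?thesis using mod_act_commutator_Sp[of n s] mod_act_commutator_z by simp
qed

lemma mod_act_mon:
  assumes "s \<in> supported {M. mon M}"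
  shows "mod_act y s \<in> supported {M. mon M}"
  unfolding mod_act_def
proof (rule comb_in_subspace[OF subspace_supported])
  fix b assume "b \<in> B"
  then show "act b s \<in> supported {M. mon M}"
    unfolding act_def using assms
    by (intro lin_in_subspace[OF subspace_supported] pm.subspace_add[OF subspace_supported]
        single_supported R_mon) (auto simp: supported_def mon_ins)
qed

lemma mod_act_least:
  assumes "u \<in> B" "\<And>b. le u b"
  shows "mod_act u s \<in> supported {u # M | M. True}"
proof -
  have "act u s = lin (\<lambda>M. z (u # M)) s"
    unfolding act_def
  proof (rule lin_cong)
    fix M show "z (ins u M) + R (length M) u M = z (u # M)"
      using act_z_le[of M u] assms by (simp add: act_z)
  qed
  also have "\<dots> \<in> supported {u # M | M. True}"
    by (intro lin_in_subspace[OF subspace_supported] single_supported) auto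
  finally show ?thesis using assms by (simp add: mod_act_basis)
qed

text \<open>If \<open>u\<close> is the least basis element, then every monomial in the image of \<open>u\<close> begins with \<open>u\<close>,
  whereas \<open>v\<close> maps the empty monomial to the expansion of \<open>v\<close> in the basis.\<close>

lemma mod_act_eq_least:
  assumes u: "u \<in> B" "\<And>b. le u b" and eq: "mod_act v (z []) = mod_act u s"
  shows "v \<in> span {u}"
proof -
  let ?r = "representation B v" and ?K = "{b. representation B v b \<noteq> 0}"
  have v: "v = (\<Sum>b\<in>?K. scale (?r b) b)"
    using sum_nonzero_representation_eq[OF independent_B, of v] span_B by simp
  have K: "finite ?K" "?K \<subseteq> B"
    using finite_representation[of B v] representation_ne_zero[of B v] by auto
  have "mod_act b (z []) = z [b]" if "b \<in> ?K" for b
    using that K by (subst mod_act_basis) (auto simp: act_z_le)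
  then have act_v: "mod_act v (z []) = (\<Sum>b\<in>?K. Poly_Mapping.single [b] (?r b))"
    by (subst v) (simp add: al.sum al.scale)
  have "?r b = 0" if "b \<noteq> u" for b
  proof -
    have "lookup (mod_act u s) [b] = 0"
      using mod_act_least[OF u, of s] that by (auto simp: supported_iff)
    then have "(\<Sum>c\<in>?K. ?r c when c = b) = 0"
      using act_v by (simp add: eq lookup_sum lookup_single)
    then show ?thesis using K(1) by (auto simp: when_def split: if_splits)
  qed
  then have "?K \<subseteq> {u}" by auto
  then have "v = scale (?r u) u"
    using v by (cases "?K = {}") (auto simp: subset_singleton_iff)
  then show ?thesis by (metis span_base span_scale insertI1)
qed

end

section \<open>The free associative algebra and the envelope of the free Lie algebra\<close>

text \<open>Words under concatenation, written additively so that finitely supported functions on them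
  form a ring under convolution: the free associative algebra.\<close>

datatype 'x word = Word (letters: "'x list")

instantiation word :: (type) monoid_add
begin

definition zero_word :: "'a word" where "0 = Word []"
definition plus_word :: "'a word \<Rightarrow> 'a word \<Rightarrow> 'a word" where
  "v + w = Word (letters v @ letters w)"

instance
  by standard (auto simp: zero_word_def plus_word_def)

end

type_synonym ('p, 'x) free_assoc = "'x word \<Rightarrow>\<^sub>0 'p"

text \<open>The coefficient of \<open>p\<close> at a word.\<close>

abbreviation cf :: "('p::zero, 'x) free_assoc \<Rightarrow> 'x list \<Rightarrow> 'p" where
  "cf p ws \<equiv> lookup p (Word ws)"

lemma free_assoc_eqI: "(\<And>ws. cf p ws = cf q ws) \<Longrightarrow> p = q"
proof (rule poly_mapping_eqI)
  fix w
  assume "\<And>ws. cf p ws = cf q ws"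
  from this[of "letters w"] show "lookup p w = lookup q w" by simp
qed

lemma poly_mapping_additive_induct [case_names zero single add]:
  fixes p :: "'k \<Rightarrow>\<^sub>0 'p::field"
  assumes "P 0" "\<And>k c. P (Poly_Mapping.single k c)" "\<And>p q. P p \<Longrightarrow> P q \<Longrightarrow> P (p + q)"
  shows "P p"
proof -
  have "P (\<Sum>k\<in>K. psc (lookup p k) (Poly_Mapping.single k 1))" if "finite K" for K
    using that
  proof induction
    case (insert k K)
    then show ?case
      by (simp add: assms(2,3))
  qed (simp add: assms(1))
  from this[of "keys p"] show ?thesis
    using lin_basis[of p] by (simp add: lin_def)
qed

lemma cf_mult:
  fixes p q :: "('p::field, 'x) free_assoc"
  shows "cf (p * q) ws = (\<Sum>i\<le>length ws. cf p (take i ws) * cf q (drop i ws))"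
proof (induction p rule: poly_mapping_additive_induct)
  case zero
  then show ?case by simp
next
  case (add p p')
  then show ?case by (simp add: lookup_add algebra_simps sum.distrib)
next
  case (single v c)
  show ?case
  proof (induction q rule: poly_mapping_additive_induct)
    case zero
    then show ?case by simp
  next
    case (add q q')
    then show ?case by (simp add: lookup_add algebra_simps sum.distrib)
  next
    case (single w d)
    obtain vs zs where vw: "v = Word vs" "w = Word zs" by (meson word.exhaust)
    have "(\<Sum>i\<le>length ws. (c when vs = take i ws) * (d when zs = drop i ws))
        = (\<Sum>i\<le>length ws. if i = length vs then (c * d when vs @ zs = ws) else 0)"
    proof (rule sum.cong)
      fix i assume i: "i \<in> {..length ws}"
      have "vs = take i ws \<and> zs = drop i ws \<longleftrightarrow> vs @ zs = ws \<and> i = length vs"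
        using i by (auto simp: append_eq_conv_conj)
      moreover have "(c when vs = take i ws) * (d when zs = drop i ws)
          = (c * d when vs = take i ws \<and> zs = drop i ws)"
        by (simp add: when_def)
      moreover have "(if i = length vs then (c * d when vs @ zs = ws) else 0)
          = (c * d when vs @ zs = ws \<and> i = length vs)"
        by (simp add: when_def)
      ultimately show "(c when vs = take i ws) * (d when zs = drop i ws)
          = (if i = length vs then (c * d when vs @ zs = ws) else 0)"
        by (simp only:)
    qed simp
    also have "\<dots> = (c * d when vs @ zs = ws)"
      by (cases "vs @ zs = ws") auto
    finally show ?case
      by (simp add: vw mult_single plus_word_def lookup_single)
  qed
qed

lemma psc_mult_left: "psc c p * q = psc c (p * q)" for p q :: "('p::field, 'x) free_assoc"
  by (rule free_assoc_eqI) (simp add: cf_mult sum_distrib_left mult.assoc)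

lemma psc_mult_right: "p * psc c q = psc c (p * q)" for p q :: "('p::field, 'x) free_assoc"
  by (rule free_assoc_eqI) (simp add: cf_mult sum_distrib_left algebra_simps)

global_interpretation assoc: lie_algebra psc "\<lambda>p q :: ('p::field, 'x) free_assoc. p * q - q * p"
  by unfold_locales (simp_all add: algebra_simps psc_mult_left psc_mult_right)


text \<open>The generators of the free associative algebra.\<close>

definition letter :: "'x \<Rightarrow> ('p::field, 'x) free_assoc" where
  "letter x = Poly_Mapping.single (Word [x]) 1"

text \<open>The Lie homomorphism from the free Lie algebra to the free associative algebra with its
  commutator bracket that takes generators to generators. Elements of its range are the Lie elements.\<close>

definition to_assoc :: "('p::field, 'x) free_lie \<Rightarrow> ('p, 'x) free_assoc" where
  "to_assoc = (THE f. lie_hom free_scale free_bracket psc (\<lambda>p q. p * q - q * p) f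
     \<and> (\<forall>x. f (free_gen x) = letter x))"

lemma to_assoc_hom: "lie_hom free_scale free_bracket psc (\<lambda>p q. p * q - q * p) to_assoc"
  unfolding to_assoc_def
  by (rule theI'[OF assoc.free_lie_universal[of letter], THEN conjunct1])

lemma to_assoc_gen [simp]: "to_assoc (free_gen x) = letter x"
  unfolding to_assoc_def
  by (rule theI'[OF assoc.free_lie_universal[of letter], THEN conjunct2, THEN spec])

global_interpretation to_assoc: Vector_Spaces.linear free_scale psc to_assoc
  by (rule to_assoc_hom[unfolded lie_hom_def, THEN conjunct1])

lemma to_assoc_bracket: "to_assoc (free_bracket u v) = to_assoc u * to_assoc v - to_assoc v * to_assoc u"
  by (rule to_assoc_hom[unfolded lie_hom_def, THEN conjunct2, THEN spec, THEN spec])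

lemma exists_order_with_least:
  "\<exists>le. (\<forall>a b. le a b \<or> le b a) \<and> (\<forall>a b c. le a b \<longrightarrow> le b c \<longrightarrow> le a c)
    \<and> (\<forall>a b. le a b \<longrightarrow> le b a \<longrightarrow> a = b) \<and> (\<forall>b. le (u::'a) b)"
proof -
  obtain r :: "'a rel" where "well_order_on UNIV r"
    using well_order_on by blast
  then have r: "refl r" "trans r" "antisym r" "total r"
    by (auto simp: well_order_on_def linear_order_on_def partial_order_on_def preorder_on_def)
  define le where "le a b \<longleftrightarrow> a = u \<or> b \<noteq> u \<and> (a, b) \<in> r" for a b
  have "(a, a) \<in> r" "(a, b) \<in> r \<or> (b, a) \<in> r" for a b
    using r by (auto simp: total_on_def refl_on_def) (metis (full_types))
  then have "le a b \<or> le b a" "le u b" for a b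
    unfolding le_def by blast+
  moreover have "le a b \<Longrightarrow> le b c \<Longrightarrow> le a c" for a b c
    using r(2) unfolding le_def trans_def by blast
  moreover have "le a b \<Longrightarrow> le b a \<Longrightarrow> a = b" for a b
    using r(3) unfolding le_def antisym_def by blast
  ultimately show ?thesis by (intro exI[of _ le]) auto
qed

text \<open>The ordered basis is chosen with \<open>u\<close> as its least element. A polynomial \<open>p\<close> in the free
  associative algebra is evaluated at the empty monomial of the corresponding module, each letter
  acting as the generator that it stands for; this turns left multiplication by a Lie element into
  its action, and \<open>mod_act_eq_least\<close> applies.\<close>

lemma right_multiple_of_lie_element:
  fixes u v :: "('p::field, 'x) free_lie"
  assumes u: "u \<noteq> 0" and eq: "to_assoc v = to_assoc u * q"
  shows "v \<in> free_lie.span {u}"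
proof -
  define B where "B = free_lie.extend_basis {u}"
  have ind: "free_lie.independent {u}" using u by simp
  have B: "free_lie.independent B" "free_lie.span B = UNIV" "u \<in> B"
    unfolding B_def using free_lie.independent_extend_basis[OF ind]
      free_lie.span_extend_basis[OF ind] free_lie.extend_basis_superset[OF ind] by auto
  obtain le where le: "\<And>a b. le a b \<or> le b a" "\<And>a b c. le a b \<Longrightarrow> le b c \<Longrightarrow> le a c"
      "\<And>a b. le a b \<Longrightarrow> le b a \<Longrightarrow> a = b" "\<And>b. le u b"
    using exists_order_with_least[of u] by blast
  interpret ordered_lie_algebra free_scale free_bracket B le
    using B le by unfold_locales auto
  interpret al: Vector_Spaces.linear free_scale psc "\<lambda>y. mod_act y s" for s by (rule linear_mod_act_left)
  interpret ar: Vector_Spaces.linear psc psc "mod_act y" for y by (rule linear_mod_act_right)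
  define wact where "wact ws = foldr (\<lambda>x. mod_act (free_gen x)) ws (z [])" for ws
  define ev where "ev = lin (\<lambda>w. wact (letters w))"
  interpret ev: Vector_Spaces.linear psc psc ev unfolding ev_def by (rule linear_lin)
  have "wact ws \<in> supported {M. mon M}" for ws
  proof (induction ws)
    case Nil
    then show ?case by (auto simp: wact_def mon_def intro: single_supported)
  next
    case (Cons x ws)
    then show ?case by (simp add: wact_def mod_act_mon)
  qed
  then have ev_mon: "ev p \<in> supported {M. mon M}" for p
    unfolding ev_def by (intro lin_in_subspace[OF subspace_supported])
  have ev_letter: "ev (letter x * p) = mod_act (free_gen x) (ev p)" for x p
  proof (rule linear_ext[where f = "\<lambda>p. ev (letter x * p)"])
    show "Vector_Spaces.linear psc psc (\<lambda>p. ev (letter x * p))"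
      by unfold_locales (simp_all add: algebra_simps ev.add ev.scale psc_mult_right)
    show "Vector_Spaces.linear psc psc (\<lambda>p. mod_act (free_gen x) (ev p))"
      by unfold_locales (simp_all add: ev.add ev.scale ar.add ar.scale)
    fix w
    show "ev (letter x * Poly_Mapping.single w 1) = mod_act (free_gen x) (ev (Poly_Mapping.single w 1))"
      by (simp add: letter_def mult_single plus_word_def ev_def wact_def)
  qed
  have ev_mult: "ev (to_assoc y * p) = mod_act y (ev p)" for y p
  proof (induction y arbitrary: p rule: free_lie_induct)
    case (gen x)
    then show ?case by (simp add: ev_letter)
  next
    case zero
    then show ?case by (simp add: to_assoc.zero ev.zero al.zero)
  next
    case (add y y')
    then show ?case by (simp add: to_assoc.add algebra_simps ev.add al.add)
  next
    case (neg y)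
    then show ?case by (simp add: to_assoc.neg ev.neg al.neg)
  next
    case (scale a y)
    then show ?case by (simp add: to_assoc.scale psc_mult_left ev.scale al.scale)
  next
    case (bracket y y')
    then show ?case
      by (simp add: to_assoc_bracket left_diff_distrib mult.assoc ev.diff mod_act_bracket[OF ev_mon])
  qed
  have "ev 1 = z []"
    unfolding single_one[symmetric] by (simp add: ev_def wact_def zero_word_def)
  then have "mod_act v (z []) = ev (to_assoc v * 1)" by (simp only: ev_mult)
  also have "\<dots> = mod_act u (ev q)" by (simp add: eq ev_mult)
  finally show ?thesis by (rule mod_act_eq_least[OF B(3) le(4)])
qed

lemma cf_letter [simp]: "cf (letter x) ws = (if ws = [x] then 1 else 0)"
  by (auto simp: letter_def lookup_single when_def)

lemma letter_nonzero: "letter x \<noteq> (0 :: ('p::field, 'x) free_assoc)"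
proof
  assume "letter x = (0 :: ('p, 'x) free_assoc)"
  then have "cf (letter x :: ('p, 'x) free_assoc) [x] = 0" by (simp only: lookup_zero)
  then show False by simp
qed

lemma to_assoc_eq_0: "to_assoc u = 0 \<longleftrightarrow> u = 0"
  for u :: "('p::field, 'x) free_lie"
proof
  fix x :: 'x
  assume u: "to_assoc u = 0"
  have x: "free_gen x \<noteq> (0 :: ('p, 'x) free_lie)"
    using letter_nonzero[of x] to_assoc.zero by (metis to_assoc_gen)
  have "u \<in> free_lie.span {free_gen x}"
    by (rule right_multiple_of_lie_element[OF x, where q = 0]) (simp add: u)
  then obtain c where c: "u = free_scale c (free_gen x)" 
    by (auto simp: free_lie.span_singleton)
  then have "c = 0" using u letter_nonzero[of x, where ?'p = 'p] by (simp add: to_assoc.scale)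
  with c show "u = 0" by simp
qed (simp add: to_assoc.zero)

lemma to_assoc_inject: "to_assoc u = to_assoc v \<longleftrightarrow> u = v"
  using to_assoc_eq_0[of "u - v"] by (simp add: to_assoc.diff)

section \<open>Automorphisms in rank two are linear\<close>

text \<open>The homogeneous component of degree \<open>n\<close>.\<close>

definition hcomp :: "nat \<Rightarrow> ('p::field, 'x) free_assoc \<Rightarrow> ('p, 'x) free_assoc" where
  "hcomp n = Poly_Mapping.mapp (\<lambda>w c. if length (letters w) = n then c else 0)"

lemma cf_hcomp [simp]: "cf (hcomp n p) ws = (if length ws = n then cf p ws else 0)"
  by (simp add: hcomp_def mapp.rep_eq in_keys_iff)

lemma cf_hcomp_mult:
  "cf (hcomp k p * hcomp j q) ws
    = (if length ws = k + j then cf p (take k ws) * cf q (drop k ws) else 0)"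
proof -
  have "cf (hcomp k p * hcomp j q) ws = (\<Sum>i\<le>length ws. if i = k
      then (if length ws = k + j then cf p (take k ws) * cf q (drop k ws) else 0) else 0)"
    unfolding cf_mult by (intro sum.cong HOL.refl) auto
  then show ?thesis by (simp del: sum.delta)
     (simp)
qed

lemma hcomp_add: "hcomp n (p + q) = hcomp n p + hcomp n q"
  and hcomp_diff: "hcomp n (p - q) = hcomp n p - hcomp n q"
  and hcomp_uminus: "hcomp n (- p) = - hcomp n p"
  and hcomp_psc: "hcomp n (psc c p) = psc c (hcomp n p)"
  by (rule free_assoc_eqI; simp add: lookup_add lookup_minus)+

lemma hcomp_mult: "hcomp n (p * q) = (\<Sum>i\<le>n. hcomp i p * hcomp (n - i) q)"
proof (rule free_assoc_eqI)
  fix ws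
  have "cf (\<Sum>i\<le>n. hcomp i p * hcomp (n - i) q) ws
      = (\<Sum>i\<le>n. if length ws = n then cf p (take i ws) * cf q (drop i ws) else 0)"
    unfolding lookup_sum cf_hcomp_mult by (intro sum.cong HOL.refl) auto
  then show "cf (hcomp n (p * q)) ws = cf (\<Sum>i\<le>n. hcomp i p * hcomp (n - i) q) ws"
    by (simp add: cf_mult)
qed

lemma subspace_range_to_assoc: "pm.subspace (range to_assoc)"
  using to_assoc.subspace_image[OF free_lie.subspace_UNIV] .

lemma commutator_in_range_to_assoc:
  "p \<in> range to_assoc \<Longrightarrow> q \<in> range to_assoc \<Longrightarrow> p * q - q * p \<in> range to_assoc"
  by (auto simp: to_assoc_bracket[symmetric])

text \<open>Lie elements form a graded subspace.\<close>

lemma hcomp_to_assoc: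
  fixes u :: "('p::field, 'x) free_lie"
  shows "hcomp n (to_assoc u) \<in> range to_assoc"
proof (induction u arbitrary: n rule: free_lie_induct)
  case (gen x)
  have "hcomp n (letter x) = (if n = 1 then letter x else 0 :: ('p, 'x) free_assoc)"
    by (rule free_assoc_eqI) auto
  moreover have "(letter x :: ('p, 'x) free_assoc) \<in> range to_assoc"
    by (metis rangeI to_assoc_gen)
  ultimately show ?case by (simp add: pm.subspace_0[OF subspace_range_to_assoc])
next
  case zero
  have "hcomp n 0 = (0 :: ('p, 'x) free_assoc)" by (rule free_assoc_eqI) simp
  then show ?case by (simp add: to_assoc.zero pm.subspace_0[OF subspace_range_to_assoc])
next
  case (add u v)
  then show ?case by (simp add: to_assoc.add hcomp_add pm.subspace_add[OF subspace_range_to_assoc])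
next
  case (neg u)
  then show ?case by (simp add: to_assoc.neg hcomp_uminus pm.subspace_neg[OF subspace_range_to_assoc])
next
  case (scale a u)
  then show ?case by (simp add: to_assoc.scale hcomp_psc pm.subspace_scale[OF subspace_range_to_assoc])
next
  case (bracket u v)
  let ?p = "to_assoc u" and ?q = "to_assoc v"
  have "(\<Sum>i\<le>n. hcomp i ?q * hcomp (n - i) ?p) = (\<Sum>i\<le>n. hcomp (n - i) ?q * hcomp i ?p)"
    by (rule sum.reindex_bij_witness[of _ "\<lambda>i. n - i" "\<lambda>i. n - i"]) auto
  then have "hcomp n (to_assoc (free_bracket u v))
      = (\<Sum>i\<le>n. hcomp i ?p * hcomp (n - i) ?q - hcomp (n - i) ?q * hcomp i ?p)"
    by (simp add: to_assoc_bracket hcomp_diff hcomp_mult sum_subtractf)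
  also have "\<dots> \<in> range to_assoc"
    by (intro pm.subspace_sum subspace_range_to_assoc commutator_in_range_to_assoc bracket)
  finally show ?case .
qed

lemma cf_to_assoc_Nil: "cf (to_assoc u) [] = 0"
  by (induction u rule: free_lie_induct)
    (simp_all add: to_assoc.zero to_assoc.add to_assoc.neg to_assoc.scale to_assoc_bracket
      lookup_add lookup_minus cf_mult)

text \<open>The degree of a polynomial; the zero polynomial has degree \<open>0\<close>.\<close>

definition wdeg :: "('p::field, 'x) free_assoc \<Rightarrow> nat" where
  "wdeg p = Max (insert 0 ((\<lambda>w. length (letters w)) ` keys p))"

lemma wdeg_le_iff: "wdeg p \<le> n \<longleftrightarrow> (\<forall>ws. cf p ws \<noteq> 0 \<longrightarrow> length ws \<le> n)"
proof -
  have "wdeg p \<le> n \<longleftrightarrow> (\<forall>w\<in>keys p. length (letters w) \<le> n)"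
    by (simp add: wdeg_def)
  also have "\<dots> \<longleftrightarrow> (\<forall>ws. cf p ws \<noteq> 0 \<longrightarrow> length ws \<le> n)"
    by (metis in_keys_iff word.collapse word.sel)
  finally show ?thesis .
qed

lemma cf_eq_0_if_wdeg_less: "wdeg p < length ws \<Longrightarrow> cf p ws = 0"
  using wdeg_le_iff[of p "wdeg p"] by (meson linorder_not_le order_refl)

lemma wdeg_attained: "p \<noteq> 0 \<Longrightarrow> \<exists>ws. length ws = wdeg p \<and> cf p ws \<noteq> 0"
proof -
  assume "p \<noteq> 0"
  then have ne: "keys p \<noteq> {}" by simp
  have "wdeg p = Max ((\<lambda>w. length (letters w)) ` keys p)"
    using ne by (simp add: wdeg_def)
  also have "\<dots> \<in> (\<lambda>w. length (letters w)) ` keys p"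
    using ne by (intro Max_in) auto
  finally obtain w where "w \<in> keys p" "wdeg p = length (letters w)" by blast
  then show ?thesis by (intro exI[of _ "letters w"]) (simp add: in_keys_iff)
qed

lemma cf_mult_top:
  assumes "wdeg p \<le> length vs" "wdeg q \<le> length ws"
  shows "cf (p * q) (vs @ ws) = cf p vs * cf q ws"
proof -
  have "cf (p * q) (vs @ ws)
      = (\<Sum>i\<le>length (vs @ ws). if i = length vs then cf p vs * cf q ws else 0)"
    unfolding cf_mult
  proof (rule sum.cong[OF HOL.refl])
    fix i assume i: "i \<in> {..length (vs @ ws)}"
    consider "i = length vs" | "i < length vs" | "i > length vs" by linarith
    then show "cf p (take i (vs @ ws)) * cf q (drop i (vs @ ws))
        = (if i = length vs then cf p vs * cf q ws else 0)"
    proof cases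
      case 2
      then have "cf q (drop i (vs @ ws)) = 0"
        using assms by (intro cf_eq_0_if_wdeg_less) simp
      with 2 show ?thesis by simp
    next
      case 3
      then have "cf p (take i (vs @ ws)) = 0"
        using assms i by (intro cf_eq_0_if_wdeg_less) simp
      with 3 show ?thesis by simp
    qed simp
  qed
  then show ?thesis by simp
qed

lemma wdeg_mult_le: "wdeg (p * q) \<le> wdeg p + wdeg q"
  unfolding wdeg_le_iff
proof (intro allI impI)
  fix ws assume "cf (p * q) ws \<noteq> 0"
  then obtain i where i: "i \<le> length ws" "cf p (take i ws) \<noteq> 0" "cf q (drop i ws) \<noteq> 0"
    unfolding cf_mult by (metis (no_types, lifting) atMost_iff mult_not_zero sum.not_neutral_contains_not_neutral)
  then have "\<not> wdeg p < length (take i ws)" "\<not> wdeg q < length (drop i ws)"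
    using cf_eq_0_if_wdeg_less by blast+
  then show "length ws \<le> wdeg p + wdeg q" using i(1) by simp
qed

text \<open>Division on the right by a word: words ending in \<open>ws\<close> lose this suffix, all others are
  discarded.\<close>

definition rquot :: "'x list \<Rightarrow> ('p::field, 'x) free_assoc \<Rightarrow> ('p, 'x) free_assoc" where
  "rquot ws p = Poly_Mapping.map_key (\<lambda>v. Word (letters v @ ws)) p"

lemma cf_rquot [simp]: "cf (rquot ws p) vs = cf p (vs @ ws)"
proof -
  have "inj (\<lambda>v. Word (letters v @ ws))"
    by (rule injI) (metis append_same_eq word.expand word.inject)
  then show ?thesis by (simp add: rquot_def map_key.rep_eq)
qed

text \<open>If \<open>ua + vb\<close> has degree at most one while \<open>v\<close> has degree at least two and \<open>b \<noteq> 0\<close>, then the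
  top components of \<open>ua\<close> and \<open>vb\<close> cancel. Reading off the coefficients at the words that end in a
  fixed longest word \<open>bs\<close> of \<open>b\<close> solves the relation for the top component of \<open>v\<close>.\<close>

lemma top_component_right_multiple:
  assumes u: "u \<noteq> 0" and b: "b \<noteq> 0" and le: "wdeg u \<le> wdeg v" and v: "2 \<le> wdeg v"
    and deg: "wdeg (u * a + v * b) \<le> 1"
  shows "\<exists>q. hcomp (wdeg v) v = hcomp (wdeg u) u * q"
proof -
  let ?k = "wdeg u" and ?l = "wdeg v" and ?m = "wdeg b"
  obtain us where us: "length us = ?k" "cf u us \<noteq> 0" using wdeg_attained[OF u] by blast
  obtain bs where bs: "length bs = ?m" "cf b bs \<noteq> 0" using wdeg_attained[OF b] by blast
  have zero: "cf (u * a + v * b) ws = 0" if "2 \<le> length ws" for ws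
    using that deg by (intro cf_eq_0_if_wdeg_less) simp
  \<comment> \<open>Otherwise a top term of \<open>ua\<close> would survive in \<open>ua + vb\<close>.\<close>
  have a: "wdeg a \<le> ?l - ?k + ?m"
  proof (rule ccontr)
    assume large: "\<not> wdeg a \<le> ?l - ?k + ?m"
    then have "a \<noteq> 0" by (auto simp: wdeg_def)
    then obtain as where as: "length as = wdeg a" "cf a as \<noteq> 0" using wdeg_attained by blast
    have "cf (v * b) (us @ as) = 0"
      using wdeg_mult_le[of v b] large le us as by (intro cf_eq_0_if_wdeg_less) simp
    moreover have "cf (u * a) (us @ as) = cf u us * cf a as"
      using us as by (intro cf_mult_top) auto
    moreover have "cf (u * a + v * b) (us @ as) = 0"
      using large le us as v by (intro zero) simp
    ultimately show False using us as by (simp add: lookup_add)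
  qed
  define q where "q = psc (- inverse (cf b bs)) (hcomp (?l - ?k) (rquot bs a))"
  have "hcomp ?l v = hcomp ?k u * q"
  proof (rule free_assoc_eqI)
    fix ws
    show "cf (hcomp ?l v) ws = cf (hcomp ?k u * q) ws"
    proof (cases "length ws = ?l")
      case True
      have "cf (u * a) (take ?k ws @ drop ?k ws @ bs) = cf u (take ?k ws) * cf a (drop ?k ws @ bs)"
        using True le a bs by (intro cf_mult_top) auto
      moreover have "cf (v * b) (ws @ bs) = cf v ws * cf b bs"
        using True bs by (intro cf_mult_top) auto
      moreover have "cf (u * a + v * b) (ws @ bs) = 0"
        using True v by (intro zero) simp
      ultimately have "cf u (take ?k ws) * cf a (drop ?k ws @ bs) + cf v ws * cf b bs = 0"
        by (simp add: lookup_add flip: append_assoc)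
      then have "cf v ws = - inverse (cf b bs) * (cf u (take ?k ws) * cf a (drop ?k ws @ bs))"
        using bs by (simp add: field_simps eq_neg_iff_add_eq_0)
      then show ?thesis
        using True le by (simp add: q_def psc_mult_right cf_hcomp_mult)
    next
      case False
      then show ?thesis using le by (simp add: q_def psc_mult_right cf_hcomp_mult)
    qed
  qed
  then show ?thesis by blast
qed

lemma letters_not_in_principal_right_ideal:
  assumes "x \<noteq> y" "cf u [] = 0" "letter x = u * a" "letter y = u * c"
  shows False
proof -
  have mult: "cf (u * q) [g] = cf u [g] * cf q []" for q g
    using assms(2) by (simp add: cf_mult)
  have "cf u [x] * cf a [] = 1" "cf u [y] * cf a [] = 0" "cf u [y] * cf c [] = 1"
    using assms(1) by (simp_all flip: mult assms(3,4))
  then show False by (metis mult_eq_0_iff zero_neq_one)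
qed

lemma wdeg_diff_less:
  assumes "wdeg p \<noteq> 0" "wdeg q \<le> wdeg p" "hcomp (wdeg p) p = hcomp (wdeg p) q"
  shows "wdeg (p - q) < wdeg p"
proof -
  have "wdeg (p - q) \<le> wdeg p - 1"
    unfolding wdeg_le_iff
  proof (intro allI impI)
    fix ws assume ne: "cf (p - q) ws \<noteq> 0"
    have "length ws \<noteq> wdeg p"
    proof
      assume "length ws = wdeg p"
      then have "cf p ws = cf q ws" using assms(3) cf_hcomp by metis
      with ne show False by (simp add: lookup_minus)
    qed
    moreover have "\<not> wdeg p < length ws"
    proof
      assume "wdeg p < length ws"
      then have "cf p ws = 0" "cf q ws = 0" using assms(2) by (auto intro: cf_eq_0_if_wdeg_less)
      with ne show False by (simp add: lookup_minus)
    qed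
    ultimately show "length ws \<le> wdeg p - 1" by simp
  qed
  then show ?thesis using assms(1) by simp
qed

text \<open>Induction on the sum of the degrees: whenever the larger degree exceeds one, a scalar multiple
  of one element can be subtracted from the other to lower it, which does not change the right
  ideal.\<close>

lemma lie_right_generators_linear:
  fixes u v :: "('p::field, 'x) free_assoc"
  assumes "x \<noteq> y" "u \<in> range to_assoc" "v \<in> range to_assoc"
    and "letter x = u * a + v * b" "letter y = u * c + v * d"
  shows "wdeg u \<le> 1 \<and> wdeg v \<le> 1"
  using assms(2-)
proof (induction "wdeg u + wdeg v" arbitrary: u v a b c d rule: less_induct)
  case less
  \<comment> \<open>By symmetry it suffices to treat the case in which \<open>v\<close> has the larger degree.\<close>
  have main: "wdeg u \<le> 1 \<and> wdeg v \<le> 1"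
    if IH: "\<And>u' v' a b c d :: ('p, 'x) free_assoc. wdeg u' + wdeg v' < wdeg u + wdeg v \<Longrightarrow> u' \<in> range to_assoc \<Longrightarrow>
        v' \<in> range to_assoc \<Longrightarrow> letter x = u' * a + v' * b \<Longrightarrow> letter y = u' * c + v' * d \<Longrightarrow>
        wdeg u' \<le> 1 \<and> wdeg v' \<le> 1"
      and u: "u \<in> range to_assoc" and v: "v \<in> range to_assoc" and le: "wdeg u \<le> wdeg v"
      and x: "letter x = u * a + v * b" and y: "letter y = u * c + v * d"
    for u v a b c d :: "('p, 'x) free_assoc"
  proof (cases "wdeg v \<le> 1")
    case True
    with le show ?thesis by simp
  next
    case False
    have Nil: "cf u [] = 0" "cf v [] = 0" using u v cf_to_assoc_Nil by auto
    have u0: "u \<noteq> 0"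
      using letters_not_in_principal_right_ideal[OF assms(1) Nil(2), of b d] x y by auto
    have "b \<noteq> 0 \<or> d \<noteq> 0"
      using letters_not_in_principal_right_ideal[OF assms(1) Nil(1), of a c] x y by auto
    moreover have deg: "wdeg (letter g :: ('p, 'x) free_assoc) \<le> 1" for g
      by (simp add: wdeg_le_iff)
    ultimately obtain q where q: "hcomp (wdeg v) v = hcomp (wdeg u) u * q"
      using top_component_right_multiple[OF u0 _ le, of b a]
        top_component_right_multiple[OF u0 _ le, of d c] False x y deg[of x] deg[of y] by auto
    obtain u' v' where u'v': "hcomp (wdeg u) u = to_assoc u'" "hcomp (wdeg v) v = to_assoc v'"
      using u v hcomp_to_assoc by (metis (no_types, lifting) imageE)
    have top0: "hcomp (wdeg p) p \<noteq> 0" if p: "p \<noteq> 0" for p :: "('p, 'x) free_assoc"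
    proof
      assume *: "hcomp (wdeg p) p = 0"
      obtain ws where "length ws = wdeg p" "cf p ws \<noteq> 0" using wdeg_attained[OF p] by blast
      then have "cf (hcomp (wdeg p) p) ws \<noteq> 0" by simp
      then show False by (simp add: *)
    qed
    have "u' \<noteq> 0" using top0[OF u0] u'v'(1) by (auto simp: to_assoc.zero)
    then have "v' \<in> free_lie.span {u'}"
      using right_multiple_of_lie_element[of u' v' q] q u'v' by simp
    then obtain s where "v' = free_scale s u'" by (auto simp: free_lie.span_singleton)
    then have s: "hcomp (wdeg v) v = psc s (hcomp (wdeg u) u)"
      using u'v' by (simp add: to_assoc.scale)
    have v0: "v \<noteq> 0" using False by (auto simp: wdeg_def)
    have uv: "wdeg u = wdeg v"
    proof -
      obtain ws where ws: "length ws = wdeg v" "cf v ws \<noteq> 0" using wdeg_attained[OF v0] by blast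
      then have "cf (psc s (hcomp (wdeg u) u)) ws \<noteq> 0" by (simp flip: s)
      then show ?thesis using ws by (auto split: if_splits)
    qed
    let ?v = "v - psc s u"
    have "wdeg (psc s u) \<le> wdeg v"
      unfolding wdeg_le_iff using uv cf_eq_0_if_wdeg_less[of u] by (metis linorder_not_le lookup_psc mult_zero_right)
    then have less: "wdeg ?v < wdeg v"
      using False s uv by (intro wdeg_diff_less) (simp_all add: hcomp_psc)
    have "wdeg u \<le> 1 \<and> wdeg ?v \<le> 1"
    proof (rule IH)
      show "wdeg u + wdeg ?v < wdeg u + wdeg v" using less by simp
      show "?v \<in> range to_assoc"
        by (intro pm.subspace_diff pm.subspace_scale subspace_range_to_assoc u v)
      show "letter x = u * (a + psc s b) + ?v * b"
        by (simp add: x algebra_simps psc_mult_left psc_mult_right)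
      show "letter y = u * (c + psc s d) + ?v * d"
        by (simp add: y algebra_simps psc_mult_left psc_mult_right)
    qed (rule u)
    then show ?thesis using uv False by simp
  qed
  show ?case
  proof (cases "wdeg u \<le> wdeg v")
    case True
    show ?thesis
      by (rule main[OF _ less.prems(1,2) True less.prems(3,4)]) (rule less.hyps)
  next
    case False
    then have le: "wdeg v \<le> wdeg u" by simp
    have x: "letter x = v * b + u * a" and y: "letter y = v * d + u * c"
      using less.prems(3,4) by (simp_all add: add.commute)
    have "wdeg v \<le> 1 \<and> wdeg u \<le> 1"
      by (rule main[OF _ less.prems(2,1) le x y]) (rule less.hyps, simp add: add.commute)
    then show ?thesis by simp
  qed
qed

lemma
  assumes "\<phi> \<in> carrier End_free_lie"
  shows End_linear: "Vector_Spaces.linear free_scale free_scale \<phi>"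
    and End_bracket: "\<phi> (free_bracket u v) = free_bracket (\<phi> u) (\<phi> v)"
  using assms by (auto simp: End_free_lie_def lie_hom_def)

text \<open>A right ideal of the free associative algebra is closed under commutators of its elements.
  Hence the image of an endomorphism lies in the right ideal generated by the images of \<open>x\<close> and \<open>y\<close>.\<close>

lemma End_image_right_ideal:
  fixes \<phi> :: "('p::field, 'x) free_lie \<Rightarrow> ('p, 'x) free_lie"
  assumes UNIV: "UNIV = {x, y}" and \<phi>: "\<phi> \<in> carrier End_free_lie"
  shows "\<exists>a b. to_assoc (\<phi> w) = to_assoc (\<phi> (free_gen x)) * a + to_assoc (\<phi> (free_gen y)) * b"
proof -
  interpret \<phi>: Vector_Spaces.linear free_scale free_scale \<phi> by (rule End_linear[OF \<phi>])
  let ?u = "to_assoc (\<phi> (free_gen x))" and ?v = "to_assoc (\<phi> (free_gen y))"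
  define I where "I = {p. \<exists>a b. p = ?u * a + ?v * b}"
  have add: "p + q \<in> I" if pq: "p \<in> I" "q \<in> I" for p q
  proof -
    obtain a b c d where "p = ?u * a + ?v * b" "q = ?u * c + ?v * d"
      using pq unfolding I_def by blast
    then have "p + q = ?u * (a + c) + ?v * (b + d)" by (simp add: algebra_simps)
    then show ?thesis unfolding I_def by blast
  qed
  have mult: "p * r \<in> I" if p: "p \<in> I" for p r
  proof -
    obtain a b where "p = ?u * a + ?v * b" using p unfolding I_def by blast
    then have "p * r = ?u * (a * r) + ?v * (b * r)" by (simp add: algebra_simps)
    then show ?thesis unfolding I_def by blast
  qed
  have scale: "psc s p \<in> I" if "p \<in> I" for s p
    using mult[OF that, of "psc s 1"] by (simp add: psc_mult_right)
  have neg: "- p \<in> I" if "p \<in> I" for p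
    using mult[OF that, of "- 1"] by simp
  have "to_assoc (\<phi> w) \<in> I"
  proof (induction w rule: free_lie_induct)
    case (gen g)
    have "g = x \<or> g = y" using UNIV by blast
    moreover have "?u = ?u * 1 + ?v * 0" "?v = ?u * 0 + ?v * 1" by simp_all
    ultimately show ?case unfolding I_def by blast
  next
    case zero
    have "(0 :: ('p, 'x) free_assoc) = ?u * 0 + ?v * 0" by simp
    then show ?case unfolding I_def \<phi>.zero to_assoc.zero by blast
  next
    case (bracket u v)
    then show ?case
      by (simp only: End_bracket[OF \<phi>] to_assoc_bracket diff_conv_add_uminus add mult neg)
  qed (simp_all add: \<phi>.add \<phi>.neg \<phi>.scale to_assoc.add to_assoc.neg to_assoc.scale add neg scale)
  then show ?thesis by (simp add: I_def)
qed

lemma to_assoc_linear_part: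
  assumes UNIV: "UNIV = {x, y}" and "x \<noteq> y" and deg: "wdeg (to_assoc w) \<le> 1"
  shows "\<exists>\<alpha> \<beta>. w = free_scale \<alpha> (free_gen x) + free_scale \<beta> (free_gen y)"
proof -
  let ?p = "to_assoc w"
  let ?w = "free_scale (cf ?p [x]) (free_gen x) + free_scale (cf ?p [y]) (free_gen y)"
  have "?p = to_assoc ?w"
  proof (rule free_assoc_eqI)
    fix ws
    consider "ws = []" | "ws = [x]" | "ws = [y]" | "length ws > 1"
      using UNIV by (cases ws rule: remdups_adj.cases) auto
    then show "cf ?p ws = cf (to_assoc ?w) ws"
    proof cases
      case 4
      then have "cf ?p ws = 0" using deg by (intro cf_eq_0_if_wdeg_less) simp
      with 4 show ?thesis by (auto simp: to_assoc.add to_assoc.scale lookup_add)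
    qed (use \<open>x \<noteq> y\<close> in \<open>auto simp: to_assoc.add to_assoc.scale lookup_add cf_to_assoc_Nil\<close>)
  qed
  then have "w = ?w" by (simp only: to_assoc_inject)
  then show ?thesis by blast
qed

theorem automorphism_linear:
  fixes \<phi> \<psi> :: "('p::field, 'x) free_lie \<Rightarrow> ('p, 'x) free_lie"
  assumes UNIV: "UNIV = {x, y}" and xy: "x \<noteq> y"
    and \<phi>: "\<phi> \<in> carrier End_free_lie" and inv: "\<And>w. \<phi> (\<psi> w) = w"
  shows "\<exists>\<alpha> \<beta>. \<phi> (free_gen g) = free_scale \<alpha> (free_gen x) + free_scale \<beta> (free_gen y)"
proof -
  let ?u = "to_assoc (\<phi> (free_gen x))" and ?v = "to_assoc (\<phi> (free_gen y))"
  have gens: "\<exists>a b. letter h = ?u * a + ?v * b" for h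
    using End_image_right_ideal[OF UNIV \<phi>, of "\<psi> (free_gen h)"] by (simp add: inv)
  obtain a b where "letter x = ?u * a + ?v * b" using gens by blast
  moreover obtain c d where "letter y = ?u * c + ?v * d" using gens by blast
  ultimately have "wdeg ?u \<le> 1 \<and> wdeg ?v \<le> 1"
    by (intro lie_right_generators_linear[OF xy]) auto
  moreover have "g = x \<or> g = y" using UNIV by blast
  ultimately show ?thesis using to_assoc_linear_part[OF UNIV xy] by blast
qed

section \<open>Endomorphisms and weights\<close>

text \<open>The endomorphism with prescribed values at the generators.\<close>

definition lie_extend :: "('x \<Rightarrow> ('p::field, 'x) free_lie) \<Rightarrow> ('p, 'x) free_lie \<Rightarrow> ('p, 'x) free_lie" where
  "lie_extend g = (THE \<phi>. lie_hom free_scale free_bracket free_scale free_bracket \<phi>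
     \<and> (\<forall>x. \<phi> (free_gen x) = g x))"

lemma lie_extend_End [simp]: "lie_extend g \<in> carrier End_free_lie"
  unfolding lie_extend_def End_free_lie_def
  by simp (rule theI'[OF free_lie.free_lie_universal[of g], THEN conjunct1])

lemma lie_extend_gen [simp]: "lie_extend g (free_gen x) = g x"
  unfolding lie_extend_def
  by (rule theI'[OF free_lie.free_lie_universal[of g], THEN conjunct2, THEN spec])

lemma End_comp: "\<phi> \<in> carrier End_free_lie \<Longrightarrow> \<psi> \<in> carrier End_free_lie \<Longrightarrow> \<phi> \<circ> \<psi> \<in> carrier End_free_lie"
  using monoid.m_closed[OF monoid_End_free_lie] by (simp add: End_free_lie_def)

lemma End_id: "id \<in> carrier End_free_lie"
  using monoid.one_closed[OF monoid_End_free_lie] by (simp add: End_free_lie_def)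

lemma
  assumes "\<phi> \<in> carrier End_free_lie"
  shows End_add: "\<phi> (u + v) = \<phi> u + \<phi> v"
    and End_scale: "\<phi> (free_scale a u) = free_scale a (\<phi> u)"
    and End_zero: "\<phi> 0 = 0"
    and End_diff: "\<phi> (u - v) = \<phi> u - \<phi> v"
proof -
  interpret Vector_Spaces.linear free_scale free_scale \<phi> by (rule End_linear[OF assms])
  show "\<phi> (u + v) = \<phi> u + \<phi> v" "\<phi> (free_scale a u) = free_scale a (\<phi> u)" "\<phi> 0 = 0"
    "\<phi> (u - v) = \<phi> u - \<phi> v"
    by (rule add scale zero diff)+
qed

lemma Units_End_iff:
  "\<phi> \<in> Units End_free_lie \<longleftrightarrow> \<phi> \<in> carrier End_free_lie \<and>
     (\<exists>\<psi>\<in>carrier End_free_lie. \<psi> \<circ> \<phi> = id \<and> \<phi> \<circ> \<psi> = id)"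
  by (simp add: Units_def End_free_lie_def)

lemma End_unitI:
  assumes "\<phi> \<in> carrier End_free_lie" "\<psi> \<in> carrier End_free_lie"
    and "\<And>x. \<psi> (\<phi> (free_gen x)) = free_gen x" "\<And>x. \<phi> (\<psi> (free_gen x)) = free_gen x"
  shows "\<phi> \<in> Units End_free_lie"
  unfolding Units_End_iff using assms
  by (auto intro!: bexI[of _ \<psi>] End_free_lie_eqI End_comp End_id)

text \<open>Diagonal substitutions, which rescale each generator by its own factor.\<close>

definition diag :: "('x \<Rightarrow> 'p::field) \<Rightarrow> ('p, 'x) free_lie \<Rightarrow> ('p, 'x) free_lie" where
  "diag c = lie_extend (\<lambda>x. free_scale (c x) (free_gen x))"

lemma diag_End [simp]: "diag c \<in> carrier End_free_lie"
  and diag_gen [simp]: "diag c (free_gen x) = free_scale (c x) (free_gen x)"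
  by (simp_all add: diag_def)

lemma diag_unit:
  assumes "\<And>x. c x \<noteq> 0" shows "diag c \<in> Units End_free_lie"
  by (rule End_unitI[where \<psi> = "diag (\<lambda>x. inverse (c x))"])
    (simp_all add: End_scale[OF diag_End] assms)

text \<open>Words are weight vectors of the diagonal substitutions.\<close>

lemma cf_to_assoc_diag: "cf (to_assoc (diag c w)) ws = prod_list (map c ws) * cf (to_assoc w) ws"
proof (induction w arbitrary: ws rule: free_lie_induct)
  case (gen x)
  then show ?case by (simp add: to_assoc.scale)
next
  case zero
  then show ?case by (simp add: End_zero[OF diag_End] to_assoc.zero)
next
  case (add u v)
  then show ?case by (simp add: End_add[OF diag_End] to_assoc.add lookup_add algebra_simps)
next
  case (neg u)
  interpret d: Vector_Spaces.linear free_scale free_scale "diag c" by (rule End_linear[OF diag_End])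
  show ?case using neg by (simp add: d.neg to_assoc.neg)
next
  case (scale a u)
  then show ?case by (simp add: End_scale[OF diag_End] to_assoc.scale)
next
  case (bracket u v)
  have mult: "prod_list (map c ws) = prod_list (map c (take i ws)) * prod_list (map c (drop i ws))" for i
    by (metis append_take_drop_id map_append prod_list.append)
  have "cf (to_assoc (diag c u) * to_assoc (diag c v)) ws
      = prod_list (map c ws) * cf (to_assoc u * to_assoc v) ws"
    if u: "\<And>ws. cf (to_assoc (diag c u)) ws = prod_list (map c ws) * cf (to_assoc u) ws"
      and v: "\<And>ws. cf (to_assoc (diag c v)) ws = prod_list (map c ws) * cf (to_assoc v) ws" for u v
    unfolding cf_mult sum_distrib_left u v
  proof (rule sum.cong[OF HOL.refl])
    fix i
    show "prod_list (map c (take i ws)) * cf (to_assoc u) (take i ws)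
          * (prod_list (map c (drop i ws)) * cf (to_assoc v) (drop i ws))
        = prod_list (map c ws) * (cf (to_assoc u) (take i ws) * cf (to_assoc v) (drop i ws))"
      unfolding mult[of i] by (simp only: mult.assoc mult.left_commute)
  qed
  from this[OF bracket] this[OF bracket(2,1)] show ?case
    by (simp add: End_bracket[OF diag_End] to_assoc_bracket lookup_minus algebra_simps)
qed

text \<open>No power of a generator other than the first occurs in a Lie element, as it cancels in each
  commutator.\<close>

lemma cf_to_assoc_replicate:
  fixes u :: "('p::field, 'x) free_lie"
  assumes "k \<noteq> 1" shows "cf (to_assoc u) (replicate k x) = 0"
proof (induction u rule: free_lie_induct)
  case (gen g)
  have "replicate k x \<noteq> [g]" using assms by (metis length_replicate length_Cons list.size(3) One_nat_def)
  then show ?case by simp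
next
  case (bracket u v)
  have "(\<Sum>i\<le>k. cf (to_assoc v) (replicate i x) * cf (to_assoc u) (replicate (k - i) x))
      = (\<Sum>i\<le>k. cf (to_assoc u) (replicate i x) * cf (to_assoc v) (replicate (k - i) x))"
    by (rule sum.reindex_bij_witness[of _ "\<lambda>i. k - i" "\<lambda>i. k - i"]) (auto simp: mult.commute)
  moreover have "(\<Sum>i\<le>k. cf (to_assoc u) (take i (replicate k x)) * cf (to_assoc v) (drop i (replicate k x)))
      = (\<Sum>i\<le>k. cf (to_assoc u) (replicate i x) * cf (to_assoc v) (replicate (k - i) x))"
    for u v :: "('p, 'x) free_lie"
    by (rule sum.cong[OF HOL.refl]) (simp add: min_def)
  ultimately show ?case
    by (simp add: to_assoc_bracket lookup_minus cf_mult del: take_replicate drop_replicate)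
qed (simp_all add: to_assoc.zero to_assoc.add to_assoc.neg to_assoc.scale lookup_add)

lemma cf_to_assoc_pair:
  fixes u :: "('p::field, 'x) free_lie"
  shows "cf (to_assoc u) [y, x] = - cf (to_assoc u) [x, y]"
proof (induction u rule: free_lie_induct)
  case (bracket u v)
  have "cf (p * q) [g, h] = cf p [] * cf q [g, h] + cf p [g] * cf q [h] + cf p [g, h] * cf q []"
    for p q :: "('p, 'x) free_assoc" and g h
    by (simp add: cf_mult atMost_Suc numeral_2_eq_2)
  then show ?case
    by (simp add: to_assoc_bracket lookup_minus cf_to_assoc_Nil)
qed (auto simp: to_assoc.zero to_assoc.add to_assoc.neg to_assoc.scale lookup_add)

lemma exists_power_neq_1:
  assumes "infinite (UNIV :: 'p::field set)" "n > 0"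
  shows "\<exists>a::'p. a \<noteq> 0 \<and> a ^ n \<noteq> 1"
proof -
  let ?p = "monom 1 n - 1 :: 'p poly"
  have "coeff ?p n = 1" using assms(2) by simp
  then have "?p \<noteq> 0" by fastforce
  then have "finite ({a. poly ?p a = 0} \<union> {0})" using poly_roots_finite[of ?p] by blast
  then obtain a where "a \<notin> {a. poly ?p a = 0} \<union> {0}"
    using assms(1) by (metis finite_subset subsetI UNIV_I)
  then show ?thesis by (auto simp: poly_monom)
qed

text \<open>The setting of the theorem: an infinite field, represented by the dummy parameter \<open>ty\<close>, and
  exactly two generators.\<close>

locale rank_two =
  fixes x y :: 'x and ty :: "'p::field itself"
  assumes infinite: "infinite (UNIV :: 'p set)" and UNIV: "UNIV = {x, y}" and xy: "x \<noteq> y"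
begin

abbreviation pair :: "'a \<Rightarrow> 'a \<Rightarrow> 'x \<Rightarrow> 'a" where
  "pair a b \<equiv> \<lambda>g. if g = x then a else b"

lemma End_eqI:
  fixes \<phi> \<psi> :: "('p, 'x) free_lie \<Rightarrow> ('p, 'x) free_lie"
  assumes "\<phi> \<in> carrier End_free_lie" "\<psi> \<in> carrier End_free_lie"
    and "\<phi> (free_gen x) = \<psi> (free_gen x)" "\<phi> (free_gen y) = \<psi> (free_gen y)"
  shows "\<phi> = \<psi>"
proof (rule End_free_lie_eqI)
  fix g
  have "g = x \<or> g = y" using UNIV by blast
  then show "\<phi> (free_gen g) = \<psi> (free_gen g)" using assms by auto
qed (rule assms)+

lemma weight: 
  fixes \<alpha> \<beta> :: 'p
  shows "prod_list (map (pair \<alpha> \<beta>) ws) = \<alpha> ^ count_list ws x * \<beta> ^ count_list ws y"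
proof (induction ws)
  case (Cons g ws)
  have "g = x \<or> g = y" using UNIV by blast
  with Cons xy show ?case by (auto simp: algebra_simps)
qed simp

text \<open>An element fixed by all rescalings of \<open>y\<close> has degree zero in \<open>y\<close>, and a Lie element in
  \<open>x\<close> alone is a multiple of \<open>x\<close>.\<close>

lemma fixed_by_diag:
  fixes w :: "('p, 'x) free_lie"
  assumes "\<And>\<beta>. \<beta> \<noteq> 0 \<Longrightarrow> diag (pair 1 \<beta>) w = w"
  shows "\<exists>c. w = free_scale c (free_gen x)"
proof -
  let ?c = "cf (to_assoc w) [x]"
  have "to_assoc w = to_assoc (free_scale ?c (free_gen x))"
  proof (rule free_assoc_eqI)
    fix ws
    show "cf (to_assoc w) ws = cf (to_assoc (free_scale ?c (free_gen x))) ws"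
    proof (cases "count_list ws y = 0")
      case True
      then have "\<forall>g\<in>set ws. g = x" using UNIV by (metis UNIV_I count_list_0_iff empty_iff insert_iff)
      then have "ws = replicate (length ws) x" by (simp add: replicate_length_same)
      then show ?thesis using cf_to_assoc_replicate[of "length ws" w x]
        by (cases "length ws = 1") (auto simp: to_assoc.scale)
    next
      case False
      then obtain \<beta> :: 'p where \<beta>: "\<beta> \<noteq> 0" "\<beta> ^ count_list ws y \<noteq> 1"
        using exists_power_neq_1[OF infinite] by blast
      have "cf (to_assoc w) ws = \<beta> ^ count_list ws y * cf (to_assoc w) ws"
        using cf_to_assoc_diag[of "pair 1 \<beta>" w ws] assms[OF \<beta>(1)] by (simp add: weight)
      then have "cf (to_assoc w) ws = 0" using \<beta>(2) by (metis mult_cancel_right2)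
      moreover have "ws \<noteq> [x]" using False xy by auto
      ultimately show ?thesis by (simp add: to_assoc.scale)
    qed
  qed
  then show ?thesis by (auto simp: to_assoc_inject)
qed

text \<open>The elements of weight \<open>(1, 1)\<close> under the diagonal automorphisms are the multiples of \<open>[x, y]\<close>.\<close>

lemma bracket_weight_space:
  fixes w :: "('p, 'x) free_lie"
  assumes w: "\<And>\<alpha> \<beta>. \<alpha> \<noteq> 0 \<Longrightarrow> \<beta> \<noteq> 0 \<Longrightarrow> diag (pair \<alpha> \<beta>) w = free_scale (\<alpha> * \<beta>) w"
  shows "\<exists>c. w = free_scale c (free_bracket (free_gen x) (free_gen y))"
proof -
  let ?b = "free_bracket (free_gen x) (free_gen y) :: ('p, 'x) free_lie"
  have one: "n = 1" if "\<And>\<alpha>::'p. \<alpha> \<noteq> 0 \<Longrightarrow> \<alpha> ^ n = \<alpha>" for n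
  proof (rule ccontr)
    assume "n \<noteq> 1"
    then consider "n = 0" | m where "n = Suc m" "m > 0" by (cases n) auto
    then show False
    proof cases
      case 1
      then show False using that exists_power_neq_1[OF infinite, of 1] by auto
    next
      case (2 m)
      then show False using that exists_power_neq_1[OF infinite, of m] by auto
    qed
  qed
  have cf_b: "cf (to_assoc ?b) ws = (if ws = [x, y] then 1 else if ws = [y, x] then - 1 else 0)" for ws
  proof -
    have prod: "letter g * letter h = (Poly_Mapping.single (Word [g, h]) 1 :: ('p, 'x) free_assoc)" for g h
      by (simp add: letter_def mult_single plus_word_def)
    show ?thesis using xy
      by (auto simp: to_assoc_bracket prod lookup_minus lookup_single when_def)
  qed
  have "to_assoc w = to_assoc (free_scale (cf (to_assoc w) [x, y]) ?b)"
  proof (rule free_assoc_eqI)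
    fix ws
    show "cf (to_assoc w) ws = cf (to_assoc (free_scale (cf (to_assoc w) [x, y]) ?b)) ws"
    proof (cases "cf (to_assoc w) ws = 0")
      case True
      then show ?thesis
        using cf_to_assoc_pair[of w y x] xy by (auto simp: to_assoc.scale cf_b)
    next
      case False
      have eq: "\<alpha> ^ count_list ws x * \<beta> ^ count_list ws y = \<alpha> * \<beta>" if "\<alpha> \<noteq> 0" "\<beta> \<noteq> 0" for \<alpha> \<beta> :: 'p
        using cf_to_assoc_diag[of "pair \<alpha> \<beta>" w ws] w[OF that] False
        by (simp add: weight to_assoc.scale)
      have "count_list ws x = 1" by (rule one) (use eq[of _ 1] in simp)
      moreover have "count_list ws y = 1" by (rule one) (use eq[of 1] in simp)
      ultimately have "ws = [x, y] \<or> ws = [y, x]"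
      proof (cases ws)
        case (Cons g vs)
        have "g = x \<or> g = y" using UNIV by blast
        then show ?thesis
          using \<open>count_list ws x = 1\<close> \<open>count_list ws y = 1\<close> Cons xy UNIV
          by (cases vs; cases "tl vs") (auto split: if_splits)
      qed simp
      then show ?thesis
        using cf_to_assoc_pair[of w y x] xy by (auto simp: to_assoc.scale cf_b)
    qed
  qed
  then show ?thesis by (auto simp: to_assoc_inject)
qed

end

section \<open>The kernel of restriction to the automorphism group\<close>

lemma (in monoid) conjugation_in_auto:
  assumes u: "u \<in> Units G"
  shows "(\<lambda>\<phi>\<in>carrier G. u \<otimes> \<phi> \<otimes> inv u) \<in> auto G"
proof -
  let ?c = "\<lambda>u. \<lambda>\<phi>\<in>carrier G. u \<otimes> \<phi> \<otimes> inv u"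
  have cl: "u \<in> carrier G" "inv u \<in> carrier G" using u by auto
  have cancel: "inv u \<otimes> (u \<otimes> w) = w" "u \<otimes> (inv u \<otimes> w) = w" if "w \<in> carrier G" for w
    using that u cl by (simp_all flip: m_assoc)
  have hom: "?c u \<in> hom G G"
    by (rule homI) (simp_all add: cl m_assoc cancel)
  have "bij_betw (?c u) (carrier G) (carrier G)"
    by (rule bij_betw_byWitness[where f' = "?c (inv u)"])
      (auto simp: cl u m_assoc cancel)
  with hom show ?thesis by (simp add: auto_def Bij_def)
qed

context rank_two
begin

lemma scalar_aut_commutes_with_units:
  fixes a :: 'p and \<phi> :: "('p, 'x) free_lie \<Rightarrow> ('p, 'x) free_lie"
  assumes "\<phi> \<in> Units End_free_lie"
  shows "scalar_aut a \<circ> \<phi> = \<phi> \<circ> scalar_aut a"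
proof -
  obtain \<psi> where \<phi>: "\<phi> \<in> carrier End_free_lie" and "\<phi> \<circ> \<psi> = id"
    using assms unfolding Units_End_iff by blast
  then have inv: "\<phi> (\<psi> w) = w" for w by (metis comp_apply id_apply)
  show ?thesis
  proof (rule End_free_lie_eqI)
    fix g
    obtain \<alpha> \<beta> where "\<phi> (free_gen g) = free_scale \<alpha> (free_gen x) + free_scale \<beta> (free_gen y)"
      using automorphism_linear[OF UNIV xy \<phi> inv] by blast
    then show "(scalar_aut a \<circ> \<phi>) (free_gen g) = (\<phi> \<circ> scalar_aut a) (free_gen g)"
      by (simp add: scalar_aut_gen End_add[OF scalar_aut_End] End_scale[OF scalar_aut_End]
          End_scale[OF \<phi>] free_lie.scale_right_distrib mult.commute)
  qed (intro End_comp scalar_aut_End \<phi>)+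
qed

lemma inner_scalar_aut_in_kernel:
  fixes a :: 'p
  assumes a: "a \<noteq> 0"
  shows "(inner_scalar_aut a :: (('p, 'x) free_lie \<Rightarrow> ('p, 'x) free_lie) \<Rightarrow> _)
    \<in> kernel (AutoGroup End_free_lie) (AutoGroup Aut_free_lie) \<tau>"
proof -
  interpret E: monoid "End_free_lie :: (('p, 'x) free_lie \<Rightarrow> ('p, 'x) free_lie) monoid"
    by (rule monoid_End_free_lie)
  have u: "scalar_aut a \<in> Units (End_free_lie :: (('p, 'x) free_lie \<Rightarrow> _) monoid)"
    using scalar_aut_in_Aut[OF a] by (simp add: units_of_carrier)
  have "inner_scalar_aut a \<phi> = \<phi>" if \<phi>: "\<phi> \<in> Units End_free_lie"
    for \<phi> :: "('p, 'x) free_lie \<Rightarrow> ('p, 'x) free_lie"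
  proof -
    have "scalar_aut a \<otimes>\<^bsub>End_free_lie\<^esub> \<phi> = \<phi> \<otimes>\<^bsub>End_free_lie\<^esub> scalar_aut a"
      using scalar_aut_commutes_with_units[OF \<phi>, of a] by (simp add: End_free_lie_def)
    then show ?thesis
      using \<phi> u by (simp add: inner_scalar_aut_def E.Units_closed E.m_assoc)
  qed
  then have "\<tau> (inner_scalar_aut a) = (\<lambda>\<phi>\<in>Units (End_free_lie :: (('p, 'x) free_lie \<Rightarrow> _) monoid). \<phi>)"
    by (auto simp: restrict_to_units_def)
  moreover have "inner_scalar_aut a \<in> auto (End_free_lie :: (('p, 'x) free_lie \<Rightarrow> _) monoid)"
    unfolding inner_scalar_aut_def by (rule E.conjugation_in_auto[OF u])
  ultimately show ?thesis
    by (simp add: kernel_def AutoGroup_def BijGroup_def units_of_carrier)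
qed

end

text \<open>An automorphism \<open>\<Phi>\<close> of the endomorphism semigroup that fixes every invertible element.\<close>

locale unit_fixing_automorphism = rank_two x y ty
  for x y :: 'x and ty :: "'p::field itself" +
  fixes \<Phi> :: "(('p, 'x) free_lie \<Rightarrow> ('p, 'x) free_lie) \<Rightarrow> ('p, 'x) free_lie \<Rightarrow> ('p, 'x) free_lie"
  assumes auto: "\<Phi> \<in> auto End_free_lie"
    and fixes_units: "\<phi> \<in> Units End_free_lie \<Longrightarrow> \<Phi> \<phi> = \<phi>"
begin

lemma Phi_End [simp]: "\<phi> \<in> carrier End_free_lie \<Longrightarrow> \<Phi> \<phi> \<in> carrier End_free_lie"
  using auto by (auto simp: auto_def hom_def)

lemma Phi_comp:
  "\<phi> \<in> carrier End_free_lie \<Longrightarrow> \<psi> \<in> carrier End_free_lie \<Longrightarrow> \<Phi> (\<phi> \<circ> \<psi>) = \<Phi> \<phi> \<circ> \<Phi> \<psi>"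
  using auto by (auto simp: auto_def hom_def End_free_lie_def)

lemma Phi_bij: "bij_betw \<Phi> (carrier End_free_lie) (carrier End_free_lie)"
  using auto by (simp add: auto_def Bij_def)

lemma Phi_inj:
  "\<phi> \<in> carrier End_free_lie \<Longrightarrow> \<psi> \<in> carrier End_free_lie \<Longrightarrow> \<Phi> \<phi> = \<Phi> \<psi> \<Longrightarrow> \<phi> = \<psi>"
  using Phi_bij by (auto simp: bij_betw_def inj_on_def)

abbreviation X :: "('p, 'x) free_lie" where "X \<equiv> free_gen x"
abbreviation Y :: "('p, 'x) free_lie" where "Y \<equiv> free_gen y"

text \<open>The endomorphism \<open>x \<mapsto> u\<close>, \<open>y \<mapsto> v\<close>.\<close>

definition endo :: "('p, 'x) free_lie \<Rightarrow> ('p, 'x) free_lie \<Rightarrow> ('p, 'x) free_lie \<Rightarrow> ('p, 'x) free_lie" where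
  "endo u v = lie_extend (pair u v)"

lemma endo_End [simp]: "endo u v \<in> carrier End_free_lie"
  and endo_X [simp]: "endo u v X = u"
  and endo_Y [simp]: "endo u v Y = v"
  using xy by (simp_all add: endo_def)

lemma eq_endo: "\<phi> \<in> carrier End_free_lie \<Longrightarrow> \<phi> X = u \<Longrightarrow> \<phi> Y = v \<Longrightarrow> \<phi> = endo u v"
  by (rule End_eqI) auto

lemma unitI:
  assumes "\<phi> \<in> carrier End_free_lie" "\<psi> \<in> carrier End_free_lie"
    and "\<psi> (\<phi> X) = X" "\<psi> (\<phi> Y) = Y" "\<phi> (\<psi> X) = X" "\<phi> (\<psi> Y) = Y"
  shows "\<phi> \<in> Units End_free_lie"
proof (rule End_unitI[OF assms(1,2)])
  fix g
  have "g = x \<or> g = y" using UNIV by blast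
  then show "\<psi> (\<phi> (free_gen g)) = free_gen g" "\<phi> (\<psi> (free_gen g)) = free_gen g"
    using assms(3-) by auto
qed

lemma gen_nonzero: "free_gen g \<noteq> (0 :: ('p, 'x) free_lie)"
  using letter_nonzero[of g, where ?'p = 'p] to_assoc.zero by (metis to_assoc_gen)

lemma endo_0_0: "endo 0 0 = (\<lambda>w. 0)"
proof (rule eq_endo[symmetric])
  show "(\<lambda>w. 0 :: ('p, 'x) free_lie) \<in> carrier End_free_lie"
    by (simp add: End_free_lie_def lie_hom_def Vector_Spaces.linear_iff free_lie.vector_space_axioms
        free_lie.bracket_self)
qed simp_all

text \<open>The zero endomorphism is the absorbing element of the semigroup.\<close>

lemma Phi_zero: "\<Phi> (endo 0 0) = endo 0 0"
proof -
  obtain \<phi> where \<phi>: "\<phi> \<in> carrier End_free_lie" "\<Phi> \<phi> = endo 0 0"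
    using Phi_bij endo_End by (metis bij_betw_imp_surj_on imageE)
  have *: "\<phi> \<circ> endo 0 0 = endo 0 0" if "\<phi> \<in> carrier End_free_lie" for \<phi>
    using that by (intro eq_endo End_comp) (simp_all add: End_zero)
  have **: "endo 0 0 \<circ> \<phi> = endo 0 0" for \<phi>
  proof
    show "(endo 0 0 \<circ> \<phi>) w = endo 0 0 w" for w
      using endo_0_0 by simp
  qed
  have "\<Phi> (endo 0 0) = \<Phi> (\<phi> \<circ> endo 0 0)" using *[OF \<phi>(1)] by simp
  also have "\<dots> = endo 0 0" using \<phi> by (simp add: Phi_comp **)
  finally show ?thesis .
qed

text \<open>The image \<open>e\<close> of the idempotent \<open>x \<mapsto> x, y \<mapsto> 0\<close> absorbs the automorphisms \<open>x \<mapsto> x, y \<mapsto> \<beta> y\<close> on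
  both sides. This gives \<open>e y = 0\<close> and \<open>e x = c x\<close>, and \<open>c = 1\<close> because \<open>e\<close> is a nonzero idempotent.\<close>

lemma Phi_idempotent: "\<Phi> (endo X 0) = endo X 0"
proof -
  let ?e = "\<Phi> (endo X 0)"
  have e: "?e \<in> carrier End_free_lie" by simp
  have diag: "diag (pair 1 \<beta>) \<in> Units End_free_lie" if "\<beta> \<noteq> 0" for \<beta> :: 'p
    using that by (intro diag_unit) simp
  have right: "?e \<circ> diag (pair 1 \<beta>) = ?e" if "\<beta> \<noteq> 0" for \<beta> :: 'p
  proof -
    have "endo X 0 \<circ> diag (pair 1 \<beta>) = endo X 0"
      using xy by (intro eq_endo End_comp) (simp_all add: End_scale[OF endo_End])
    then show ?thesis using Phi_comp[of "endo X 0" "diag (pair 1 \<beta>)"] fixes_units[OF diag[OF that]] by simp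
  qed
  have left: "diag (pair 1 \<beta>) \<circ> ?e = ?e" if "\<beta> \<noteq> 0" for \<beta> :: 'p
  proof -
    have "diag (pair 1 \<beta>) \<circ> endo X 0 = endo X 0"
      by (intro eq_endo End_comp) (simp_all add: End_zero[OF diag_End])
    then show ?thesis using Phi_comp[of "diag (pair 1 \<beta>)" "endo X 0"] fixes_units[OF diag[OF that]] by simp
  qed
  have Y: "?e Y = 0"
  proof -
    obtain \<beta> :: 'p where \<beta>: "\<beta> \<noteq> 0" "\<beta> \<noteq> 1" using exists_power_neq_1[OF infinite, of 1] by auto
    have "free_scale \<beta> (?e Y) = ?e Y"
      using fun_cong[OF right[OF \<beta>(1)], of Y] xy by (simp add: End_scale[OF e])
    then have "free_scale (\<beta> - 1) (?e Y) = 0" by (simp add: free_lie.scale_left_diff_distrib)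
    then show ?thesis using \<beta>(2) by simp
  qed
  obtain c where c: "?e X = free_scale c X"
    using fixed_by_diag[of "?e X"] left by (metis comp_apply)
  have "endo X 0 \<circ> endo X 0 = endo X 0"
    by (intro eq_endo End_comp) (simp_all add: End_zero[OF endo_End])
  then have "?e (?e X) = ?e X" using Phi_comp[of "endo X 0" "endo X 0"] by (metis comp_apply endo_End)
  then have "free_scale (c * c - c) X = 0"
    by (simp add: c End_scale[OF e] free_lie.scale_left_diff_distrib)
  then have "c * (c - 1) = 0" using gen_nonzero by (simp add: algebra_simps)
  moreover have "c \<noteq> 0"
  proof
    assume "c = 0"
    then have "?e = endo 0 0" using c Y by (intro eq_endo) auto
    then have "endo X 0 = endo 0 0" using Phi_inj[of "endo X 0" "endo 0 0"] Phi_zero by simp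
    then show False using gen_nonzero by (metis endo_X)
  qed
  ultimately have "c = 1" by simp
  then show ?thesis using c Y by (intro eq_endo) auto
qed

text \<open>The endomorphisms \<open>x \<mapsto> u, y \<mapsto> 0\<close> correspond to the elements \<open>u\<close>, and \<open>\<Phi>\<close> permutes them; \<open>s\<close> is the
  induced map on elements.\<close>

definition s :: "('p, 'x) free_lie \<Rightarrow> ('p, 'x) free_lie" where
  "s u = \<Phi> (endo u 0) X"

lemma Phi_endo_0: "\<Phi> (endo u 0) = endo (s u) 0"
proof (rule eq_endo)
  have "endo u 0 \<circ> endo X 0 = endo u 0"
    by (intro eq_endo End_comp) (simp_all add: End_zero[OF endo_End])
  then have "\<Phi> (endo u 0) = \<Phi> (endo u 0) \<circ> endo X 0"
    using Phi_comp[of "endo u 0" "endo X 0"] Phi_idempotent by simp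
  then show "\<Phi> (endo u 0) Y = 0"
    by (metis Phi_End End_zero comp_apply endo_End endo_Y)
qed (simp_all add: s_def)

lemma s_equivariant:
  assumes "\<phi> \<in> carrier End_free_lie"
  shows "s (\<phi> u) = \<Phi> \<phi> (s u)"
proof -
  have "\<phi> \<circ> endo u 0 = endo (\<phi> u) 0"
    using assms by (intro eq_endo End_comp) (simp_all add: End_zero)
  then have "endo (s (\<phi> u)) 0 = \<Phi> \<phi> \<circ> endo (s u) 0"
    using Phi_comp[OF assms, of "endo u 0"] by (simp add: Phi_endo_0)
  then show ?thesis by (metis comp_apply endo_X)
qed

lemma s_unit: "\<phi> \<in> Units End_free_lie \<Longrightarrow> s (\<phi> u) = \<phi> (s u)"
  using s_equivariant[of \<phi> u] fixes_units[of \<phi>] Units_End_iff by metis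

lemma s_inj: "s u = s v \<Longrightarrow> u = v"
  using Phi_inj[of "endo u 0" "endo v 0"] Phi_endo_0 by (metis endo_End endo_X)

lemma s_X: "s X = X"
  by (simp add: s_def Phi_idempotent)

lemma s_0: "s 0 = 0"
  by (simp add: s_def Phi_zero)

lemma s_Y: "s Y = Y"
proof -
  have "endo Y X \<in> Units End_free_lie"
    by (rule unitI[where \<psi> = "endo Y X"]) simp_all
  from s_unit[OF this, of X] show ?thesis by (simp add: s_X)
qed

text \<open>The map \<open>s\<close> respects substitution into an element \<open>p\<close>. So its values at \<open>x + y\<close>, \<open>\<alpha> x\<close> and \<open>[x, y]\<close>
  determine how it treats sums, scalar multiples and brackets.\<close>

lemma s_endo: "s (endo u v p) = endo (s u) (s v) (s p)"
proof -
  have "\<Phi> (endo u v) = endo (s u) (s v)"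
    using s_equivariant[OF endo_End, of u v X] s_equivariant[OF endo_End, of u v Y]
    by (intro eq_endo) (simp_all add: s_X s_Y)
  then show ?thesis using s_equivariant[OF endo_End, of u v p] by simp
qed

lemma s_add: "s (u + v) = s u + s v"
proof -
  have "endo (X + Y) Y \<in> Units End_free_lie"
    by (rule unitI[where \<psi> = "endo (X - Y) Y"])
      (simp_all add: End_add[OF endo_End] End_diff[OF endo_End])
  from s_unit[OF this, of X] have "s (X + Y) = X + Y" by (simp add: s_X)
  then show ?thesis using s_endo[of u v "X + Y"] by (simp add: End_add[OF endo_End])
qed

lemma s_scale: "s (free_scale a u) = free_scale a (s u)"
proof (cases "a = 0")
  case False
  then have "diag (pair a 1) \<in> Units End_free_lie" by (intro diag_unit) simp
  from s_unit[OF this, of X] have "s (free_scale a X) = free_scale a X" by (simp add: s_X)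
  then show ?thesis using s_endo[of u 0 "free_scale a X"] by (simp add: End_scale[OF endo_End])
qed (simp add: s_0)

lemma s_bracket: "\<exists>a. a \<noteq> 0 \<and> (\<forall>u v. s (free_bracket u v) = free_scale a (free_bracket (s u) (s v)))"
proof -
  let ?b = "free_bracket X Y"
  have "diag (pair \<alpha> \<beta>) (s ?b) = free_scale (\<alpha> * \<beta>) (s ?b)" if "\<alpha> \<noteq> 0" "\<beta> \<noteq> 0" for \<alpha> \<beta>
  proof -
    have "diag (pair \<alpha> \<beta>) \<in> Units End_free_lie" using that by (intro diag_unit) simp
    moreover have "diag (pair \<alpha> \<beta>) ?b = free_scale (\<alpha> * \<beta>) ?b"
      using xy by (simp add: End_bracket[OF diag_End] free_lie.bracket_scale_left free_lie.bracket_scale_right)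
    ultimately show ?thesis using s_unit[of "diag (pair \<alpha> \<beta>)" ?b] by (simp add: s_scale)
  qed
  then obtain a where a: "s ?b = free_scale a ?b" using bracket_weight_space by blast
  have "?b \<noteq> 0"
  proof
    assume "?b = 0"
    then have "letter x * letter y - letter y * letter x = (0 :: ('p, 'x) free_assoc)"
      using to_assoc_bracket[of X Y] by (simp add: to_assoc.zero)
    then have "cf (letter x * letter y - letter y * letter x :: ('p, 'x) free_assoc) [x, y] = 0" by simp
    then show False using xy
      by (simp add: letter_def mult_single plus_word_def lookup_minus lookup_single when_def)
  qed
  then have "a \<noteq> 0" using s_inj[of ?b 0] a s_0 by auto
  moreover have "s (free_bracket u v) = free_scale a (free_bracket (s u) (s v))" for u v
    using s_endo[of u v ?b] by (simp add: a End_bracket[OF endo_End] End_scale[OF endo_End])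
  ultimately show ?thesis by blast
qed

theorem is_inner: "\<exists>a. a \<noteq> 0 \<and> \<Phi> = inner_scalar_aut a"
proof -
  interpret E: monoid "End_free_lie :: (('p, 'x) free_lie \<Rightarrow> ('p, 'x) free_lie) monoid"
    by (rule monoid_End_free_lie)
  obtain a where a: "a \<noteq> 0" and br: "\<And>u v. s (free_bracket u v) = free_scale a (free_bracket (s u) (s v))"
    using s_bracket by blast
  let ?f = "scalar_aut a :: ('p, 'x) free_lie \<Rightarrow> _"
  interpret f: Vector_Spaces.linear free_scale free_scale ?f by (rule End_linear[OF scalar_aut_End])
  have f: "?f u = free_scale a (s u)" for u
  proof (induction u rule: free_lie_induct)
    case (gen g)
    have "g = x \<or> g = y" using UNIV by blast
    then show ?case by (auto simp: scalar_aut_gen s_X s_Y)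
  next
    case zero
    then show ?case by (simp add: s_0)
  next
    case (add u v)
    then show ?case by (simp add: f.add s_add free_lie.scale_right_distrib)
  next
    case (neg u)
    then show ?case using s_scale[of "- 1" u] by (simp add: f.neg)
  next
    case (scale b u)
    then show ?case by (simp add: f.scale s_scale free_lie.scale_left_commute)
  next
    case (bracket u v)
    then show ?case
      by (simp add: End_bracket[OF scalar_aut_End] br free_lie.bracket_scale_left free_lie.bracket_scale_right)
  qed
  have u: "?f \<in> Units End_free_lie"
    using scalar_aut_in_Aut[OF a] by (simp add: units_of_carrier)
  have "\<Phi> \<phi> = inner_scalar_aut a \<phi>" for \<phi>
  proof (cases "\<phi> \<in> carrier End_free_lie")
    case True
    have "\<Phi> \<phi> \<circ> ?f = ?f \<circ> \<phi>"
      by (rule ext) (simp add: f End_scale[OF Phi_End[OF True]] s_equivariant[OF True])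
    then have "\<Phi> \<phi> \<otimes>\<^bsub>End_free_lie\<^esub> ?f = ?f \<otimes>\<^bsub>End_free_lie\<^esub> \<phi>"
      by (simp add: End_free_lie_def)
    then have "inner_scalar_aut a \<phi> = \<Phi> \<phi> \<otimes>\<^bsub>End_free_lie\<^esub> ?f \<otimes>\<^bsub>End_free_lie\<^esub> inv\<^bsub>End_free_lie\<^esub> ?f"
      using True by (simp add: inner_scalar_aut_def)
    also have "\<dots> = \<Phi> \<phi>" using True u by (simp add: E.m_assoc E.Units_closed)
    finally show ?thesis by simp
  next
    case False
    then show ?thesis
      using auto by (auto simp: inner_scalar_aut_def auto_def Bij_def extensional_def)
  qed
  then show ?thesis using a by blast
qed

end

theorem mainTheorem7:
  assumes "infinite (UNIV :: 'p::field set)"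
    and "CARD('x) = 2"
  shows "kernel (AutoGroup End_free_lie) (AutoGroup Aut_free_lie)
           (\<tau> :: ((('p, 'x) free_lie \<Rightarrow> ('p, 'x) free_lie) \<Rightarrow> _) \<Rightarrow> _)
         = {inner_scalar_aut a | a. a \<noteq> 0}"
proof -
  obtain x y :: 'x where xy: "UNIV = {x, y}" "x \<noteq> y"
    using assms(2) by (meson card_2_iff)
  interpret rank_two x y "TYPE('p)"
    by unfold_locales (use assms(1) xy in auto)
  show ?thesis
  proof (intro equalityI subsetI)
    fix \<Phi> :: "(('p, 'x) free_lie \<Rightarrow> ('p, 'x) free_lie) \<Rightarrow> ('p, 'x) free_lie \<Rightarrow> ('p, 'x) free_lie"
    assume "\<Phi> \<in> kernel (AutoGroup End_free_lie) (AutoGroup Aut_free_lie) \<tau>"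
    then have \<Phi>: "\<Phi> \<in> auto End_free_lie"
      and "restrict \<Phi> (Units End_free_lie) = (\<lambda>\<phi>\<in>Units End_free_lie. \<phi>)"
      by (simp_all add: kernel_def AutoGroup_def BijGroup_def units_of_carrier restrict_to_units_def)
    then have "\<Phi> \<phi> = \<phi>" if "\<phi> \<in> Units End_free_lie" for \<phi>
      using that by (metis restrict_apply')
    then interpret unit_fixing_automorphism x y "TYPE('p)" \<Phi>
      using \<Phi> by unfold_locales auto
    show "\<Phi> \<in> {inner_scalar_aut a | a. a \<noteq> 0}" using is_inner by blast
  qed (use inner_scalar_aut_in_kernel in auto)
qed

end
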